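(* Fix nonzero integers $a_1,\dots,a_5$ with $a_1+\cdots+a_5=0$. For every $\varepsilon>0$ there exist $\delta>0$ and $n_0$ such that the following holds for all $n\ge n_0$. Suppose $X_1,\dots,X_5\subseteq\{1,\dots,n\}$ satisfy: (a) for each $i$, the number of nontrivial solutions $(x_1,x_2,x_3,x_4)\in X_i^4$ to $x_1+x_2=x_3+x_4$ is at most $\delta n$, where a solution is trivial if $(x_1,x_2)=(x_3,x_4)$ or $(x_1,x_2)=(x_4,x_3)$; and (b) the number of solutions to $a_1x_1+\cdots+a_5x_5=0$ with $x_1\in X_1,\dots,x_5\in X_5$ is at most $\delta n^{3/2}$. Then one can remove at most $\varepsilon\sqrt n$ elements from each $X_i$ so that, for the remaining sets $X_1',\dots,X_5'$, there is no solution to $a_1x_1+\cdots+a_5x_5=0$ with $x_1\in X_1',\dots,x_5\in X_5'$.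
   Context: In asymptotic form: $o(n)$ nontrivial additive quadruples in each $X_i$ and $o(n^{3/2})$ solutions imply that removing $o(\sqrt n)$ elements from each $X_i$ destroys all solutions. *)

theory Defs
  imports "HOL-Analysis.Analysis" "HOL-Library.FuncSet"
begin

definition nontriv_add_quads :: "int set \<Rightarrow> nat" where
  "nontriv_add_quads A = card {(x1, x2, x3, x4). x1 \<in> A \<and> x2 \<in> A \<and> x3 \<in> A \<and> x4 \<in> A \<and>
      x1 + x2 = x3 + x4 \<and> \<not> ((x1, x2) = (x3, x4)) \<and> \<not> ((x1, x2) = (x4, x3))}"

definition lin_solutions :: "(nat \<Rightarrow> int) \<Rightarrow> (nat \<Rightarrow> int set) \<Rightarrow> (nat \<Rightarrow> int) set" where
  "lin_solutions a X = {x \<in> PiE {0..<5} X. (\<Sum>i<5. a i * x i) = 0}"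

end

theory Submission
  imports Defs
begin

text \<open>
  Dilating by the coefficients turns the problem into one about solutions of
  \<open>y0 + \<dots> + y4 = 0\<close> with \<open>yi \<in> Y i\<close> in the integers modulo some \<open>N\<close> of order \<open>n\<close>.
  Put \<open>f i = sqrt N * 1_(Y i)\<close>. Having few nontrivial additive quadruples means that the Fourier
  transforms of the \<open>f i\<close> are bounded in \<open>\<ell>^4\<close>, so by Hoelder the solution count is stable under
  perturbations that are small in the sup norm of the Fourier transform. Smoothing \<open>f i\<close> over a
  Bohr set of its large spectrum (which has bounded size) is such a perturbation.

  Since almost all differences in \<open>Y i\<close> occur only once, the smoothed functions have absolutely
  bounded \<open>L^2\<close> norm as soon as the exceptional quadruples are negligible against the density of
  the Bohr set. Hence along a rapidly decreasing sequence of scales the \<open>L^2\<close> norms stabilise: for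
  some scale \<open>\<eta>\<close> the smoothings at \<open>\<eta>\<close> and at a far smaller scale \<open>\<eta>'\<close> are close in \<open>L^2\<close>.
  Remove the points of \<open>Y i\<close> at which the coarse smoothing is small, or around which the two
  smoothings differ much on average at an intermediate scale \<open>\<zeta>\<close>. A surviving solution would be
  surrounded by so many solutions weighted by the fine smoothings that the count at scale \<open>\<eta>'\<close>
  exceeds what the hypothesis allows.
\<close>

section \<open>Fourier analysis modulo N\<close>

locale cyclic =
  fixes N :: nat
  assumes N_pos: "N > 0"
begin

abbreviation R :: "int set" where "R \<equiv> {0..<int N}"

definition periodic :: "(int \<Rightarrow> 'b) \<Rightarrow> bool" where
  "periodic g \<longleftrightarrow> (\<forall>x. g (x + int N) = g x)"

lemma periodic_mult: "periodic g \<Longrightarrow> g (x + k * int N) = g x"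
proof (induction k rule: int_induct[where k = 0])
  case base
  then show ?case by simp
next
  case (step1 i)
  have "g (x + (i + 1) * int N) = g ((x + i * int N) + int N)"
    by (simp add: algebra_simps)
  then show ?case using step1 by (simp add: periodic_def)
next
  case (step2 i)
  have "g (x + i * int N) = g ((x + (i - 1) * int N) + int N)"
    by (simp add: algebra_simps)
  then show ?case using step2 by (simp add: periodic_def)
qed

lemma periodic_cong:
  assumes "periodic g" "int N dvd x - y"
  shows "g x = g y"
proof -
  obtain k where "x - y = int N * k" using assms(2) by (auto simp: dvd_def)
  then have "x = y + k * int N" by (simp add: algebra_simps)
  then show ?thesis using periodic_mult[OF assms(1)] by simp
qed

lemma dvd_mod_diff: "int N dvd x mod int N - x"
  by (metis dvd_minus_mod dvd_minus_iff minus_diff_eq)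

lemma periodic_mod: "periodic g \<Longrightarrow> g (x mod int N) = g x"
  by (rule periodic_cong) (auto simp: dvd_mod_diff)

lemma mod_in_R: "x mod int N \<in> R"
  using N_pos by simp

lemma sum_shift:
  fixes g :: "int \<Rightarrow> 'b::comm_monoid_add"
  assumes "periodic g"
  shows "(\<Sum>x\<in>R. g (x + t)) = (\<Sum>x\<in>R. g x)"
  by (rule sum.reindex_bij_witness[where i = "\<lambda>x. (x - t) mod int N" and j = "\<lambda>x. (x + t) mod int N"])
    (use N_pos assms in \<open>auto simp: mod_simps periodic_mod\<close>)

lemma sum_minus:
  fixes g :: "int \<Rightarrow> 'b::comm_monoid_add"
  assumes "periodic g"
  shows "(\<Sum>x\<in>R. g (t - x)) = (\<Sum>x\<in>R. g x)"
  by (rule sum.reindex_bij_witness[where i = "\<lambda>x. (t - x) mod int N" and j = "\<lambda>x. (t - x) mod int N"])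
    (use N_pos assms in \<open>auto simp: mod_simps periodic_mod\<close>)

section \<open>Additive characters modulo \<open>N\<close> and Fourier inversion\<close>

definition e :: "int \<Rightarrow> complex" where
  "e k = cis (2 * pi * real_of_int k / real N)"

lemma e_add: "e (a + b) = e a * e b"
  by (simp add: e_def cis_mult add_divide_distrib distrib_left)

lemma e_0 [simp]: "e 0 = 1"
  by (simp add: e_def)

lemma e_minus: "e (- a) = cnj (e a)"
  by (simp add: e_def cis_cnj)

lemma cmod_e [simp]: "cmod (e a) = 1"
  by (simp add: e_def)

lemma e_N: "e (int N * k) = 1"
proof -
  have "2 * pi * real_of_int (int N * k) / real N = 2 * pi * of_int k"
    using N_pos by simp
  then show ?thesis by (simp add: e_def cis_multiple_2pi del: of_int_mult)
qed

lemma e_cong: "int N dvd x - y \<Longrightarrow> e x = e y"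
proof -
  assume "int N dvd x - y"
  then obtain k where "x = y + int N * k" by (auto simp: dvd_def algebra_simps)
  then show ?thesis by (simp add: e_add e_N)
qed

lemma e_eq_1_iff: "e x = 1 \<longleftrightarrow> int N dvd x"
proof
  assume "e x = 1"
  then have "cos (2 * pi * real_of_int x / real N) = 1"
    by (simp add: e_def complex_eq_iff)
  then obtain k :: int where "2 * pi * real_of_int x / real N = of_int k * 2 * pi"
    by (auto simp: cos_one_2pi_int)
  then have "real_of_int x = of_int (k * int N)"
    using N_pos by (simp add: field_simps)
  then have "x = k * int N" by linarith
  then show "int N dvd x" by simp
qed (auto simp: dvd_def e_N)

lemma periodic_e: "periodic (\<lambda>x. e (k * x))" "periodic (\<lambda>x. e (x * k))"
  by (auto simp: periodic_def intro!: e_cong simp: algebra_simps)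

text \<open>Orthogonality of characters: shifting \<open>k\<close> by one multiplies the sum by
  \<open>e x\<close>, so the sum vanishes unless \<open>e x = 1\<close>.\<close>

lemma sum_e: "(\<Sum>k\<in>R. e (k * x)) = (if int N dvd x then of_nat N else 0)"
proof (cases "int N dvd x")
  case True
  then have "e (k * x) = 1" for k by (simp add: e_eq_1_iff)
  then show ?thesis using True by simp
next
  case False
  have "(\<Sum>k\<in>R. e (k * x)) = (\<Sum>k\<in>R. e ((k + 1) * x))"
    using sum_shift[OF periodic_e(2)[of x], of 1] by simp
  also have "\<dots> = e x * (\<Sum>k\<in>R. e (k * x))"
    by (simp add: distrib_right e_add sum_distrib_left mult.commute[of _ "e x"])
  finally have "(1 - e x) * (\<Sum>k\<in>R. e (k * x)) = 0" by (simp add: algebra_simps)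
  moreover have "1 - e x \<noteq> 0" using False by (simp add: e_eq_1_iff)
  ultimately show ?thesis using False by simp
qed

text \<open>Normalised by averaging over \<open>x\<close>, with plain summation over frequencies, so
  that \<open>ft_inversion\<close> and \<open>T_fourier\<close> carry no powers of
  \<open>N\<close>.\<close>

definition ft :: "(int \<Rightarrow> real) \<Rightarrow> int \<Rightarrow> complex" where
  "ft f k = (\<Sum>x\<in>R. of_real (f x) * e (- (k * x))) / of_nat N"

lemma ft_inversion:
  assumes "periodic f"
  shows "of_real (f x) = (\<Sum>k\<in>R. ft f k * e (k * x))"
proof -
  have "(\<Sum>k\<in>R. ft f k * e (k * x)) =
      (\<Sum>k\<in>R. \<Sum>y\<in>R. of_real (f y) * e (k * (x - y)) / of_nat N)"
    unfolding ft_def sum_divide_distrib sum_distrib_right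
  proof (intro sum.cong refl)
    fix k y
    have "e (k * (x - y)) = e (- (k * y)) * e (k * x)"
      by (simp add: e_add[symmetric] algebra_simps)
    then show "of_real (f y) * e (- (k * y)) / of_nat N * e (k * x) = of_real (f y) * e (k * (x - y)) / of_nat N"
      by simp
  qed
  also have "\<dots> = (\<Sum>y\<in>R. \<Sum>k\<in>R. of_real (f y) * e (k * (x - y)) / of_nat N)"
    by (rule sum.swap)
  also have "\<dots> = (\<Sum>y\<in>R. of_real (f y) * (\<Sum>k\<in>R. e (k * (x - y))) / of_nat N)"
    by (simp add: sum_distrib_left sum_divide_distrib)
  also have "\<dots> = (\<Sum>y\<in>R. if y = x mod int N then of_real (f y) else 0)"
  proof (intro sum.cong refl)
    fix y assume y: "y \<in> R"
    have "int N dvd x - y \<longleftrightarrow> y = x mod int N"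
      using y by (metis atLeastLessThan_iff mod_eq_dvd_iff mod_pos_pos_trivial)
    then show "of_real (f y) * (\<Sum>k\<in>R. e (k * (x - y))) / of_nat N =
        (if y = x mod int N then of_real (f y) else (0::complex))"
      using N_pos by (simp add: sum_e)
  qed
  also have "\<dots> = of_real (f (x mod int N))"
    using mod_in_R by (subst sum.delta) auto
  finally show ?thesis using assms by (simp add: periodic_mod)
qed

section \<open>The normalised count of zero-sum quintuples\<close>

definition T :: "(nat \<Rightarrow> int \<Rightarrow> real) \<Rightarrow> real" where
  "T f = (\<Sum>y0\<in>R. \<Sum>y1\<in>R. \<Sum>y2\<in>R. \<Sum>y3\<in>R.
      f 0 y0 * f 1 y1 * f 2 y2 * f 3 y3 * f 4 (- (y0 + y1 + y2 + y3))) / real N ^ 4"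

lemma sum_swap4:
  fixes G :: "int \<Rightarrow> int \<Rightarrow> int \<Rightarrow> int \<Rightarrow> int \<Rightarrow> 'b::comm_monoid_add"
  shows "(\<Sum>k\<in>K. \<Sum>y0\<in>A. \<Sum>y1\<in>B. \<Sum>y2\<in>C. \<Sum>y3\<in>D. G k y0 y1 y2 y3) =
    (\<Sum>y0\<in>A. \<Sum>y1\<in>B. \<Sum>y2\<in>C. \<Sum>y3\<in>D. \<Sum>k\<in>K. G k y0 y1 y2 y3)"
  by (subst sum.swap, rule sum.cong[OF refl], subst sum.swap, rule sum.cong[OF refl],
      subst sum.swap, rule sum.cong[OF refl], rule sum.swap)

lemma sum_factor4:
  fixes g0 g1 g2 g3 :: "int \<Rightarrow> 'b::comm_semiring_0"
  shows "(\<Sum>y0\<in>A. \<Sum>y1\<in>B. \<Sum>y2\<in>C. \<Sum>y3\<in>D. g0 y0 * g1 y1 * g2 y2 * g3 y3 * z) =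
    sum g0 A * sum g1 B * sum g2 C * sum g3 D * z"
  by (simp only: sum_distrib_left[symmetric] sum_distrib_right[symmetric])

text \<open>Expanding the first four transforms leaves, for each \<open>y0, ..., y3\<close>, an
  inversion sum for \<open>f 4\<close> at the point completing a zero sum. That point need not lie
  in \<open>R\<close>, which is where periodicity of \<open>f 4\<close> enters.\<close>

lemma T_fourier:
  assumes "periodic (f 4)"
  shows "of_real (T f) = (\<Sum>k\<in>R. ft (f 0) k * ft (f 1) k * ft (f 2) k * ft (f 3) k * ft (f 4) k)"
proof -
  let ?g = "\<lambda>i k y. of_real (f i y) * e (- (k * y)) / of_nat N :: complex"
  have "(\<Sum>k\<in>R. ft (f 0) k * ft (f 1) k * ft (f 2) k * ft (f 3) k * ft (f 4) k) =
     (\<Sum>k\<in>R. \<Sum>y0\<in>R. \<Sum>y1\<in>R. \<Sum>y2\<in>R. \<Sum>y3\<in>R. ?g 0 k y0 * ?g 1 k y1 * ?g 2 k y2 * ?g 3 k y3 * ft (f 4) k)"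
    unfolding ft_def[of "f 0"] ft_def[of "f 1"] ft_def[of "f 2"] ft_def[of "f 3"] sum_divide_distrib sum_factor4 ..
  also have "\<dots> = (\<Sum>y0\<in>R. \<Sum>y1\<in>R. \<Sum>y2\<in>R. \<Sum>y3\<in>R. \<Sum>k\<in>R. ?g 0 k y0 * ?g 1 k y1 * ?g 2 k y2 * ?g 3 k y3 * ft (f 4) k)"
    by (rule sum_swap4)
  also have "\<dots> = (\<Sum>y0\<in>R. \<Sum>y1\<in>R. \<Sum>y2\<in>R. \<Sum>y3\<in>R.
      of_real (f 0 y0 * f 1 y1 * f 2 y2 * f 3 y3 * f 4 (- (y0 + y1 + y2 + y3)) / real N ^ 4))"
  proof (intro sum.cong refl)
    fix y0 y1 y2 y3
    have "(\<Sum>k\<in>R. ?g 0 k y0 * ?g 1 k y1 * ?g 2 k y2 * ?g 3 k y3 * ft (f 4) k) =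
       (\<Sum>k\<in>R. of_real (f 0 y0 * f 1 y1 * f 2 y2 * f 3 y3) / of_nat N ^ 4 * (ft (f 4) k * e (k * (- (y0 + y1 + y2 + y3)))))"
    proof (intro sum.cong refl)
      fix k
      have "e (k * (- (y0 + y1 + y2 + y3))) = e (- (k * y0)) * e (- (k * y1)) * e (- (k * y2)) * e (- (k * y3))"
        by (simp add: e_add[symmetric] algebra_simps)
      then show "?g 0 k y0 * ?g 1 k y1 * ?g 2 k y2 * ?g 3 k y3 * ft (f 4) k =
        of_real (f 0 y0 * f 1 y1 * f 2 y2 * f 3 y3) / of_nat N ^ 4 * (ft (f 4) k * e (k * (- (y0 + y1 + y2 + y3))))"
        by (simp add: power4_eq_xxxx)
    qed
    also have "\<dots> = of_real (f 0 y0 * f 1 y1 * f 2 y2 * f 3 y3) / of_nat N ^ 4 * of_real (f 4 (- (y0 + y1 + y2 + y3)))"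
      unfolding sum_distrib_left[symmetric] ft_inversion[OF assms, symmetric] ..
    also have "\<dots> = of_real (f 0 y0 * f 1 y1 * f 2 y2 * f 3 y3 * f 4 (- (y0 + y1 + y2 + y3)) / real N ^ 4)"
      by simp
    finally show "(\<Sum>k\<in>R. ?g 0 k y0 * ?g 1 k y1 * ?g 2 k y2 * ?g 3 k y3 * ft (f 4) k) = \<dots>" .
  qed
  also have "\<dots> = of_real (T f)"
    unfolding T_def sum_divide_distrib of_real_sum ..
  finally show ?thesis ..
qed

section \<open>Additive energy as a fourth moment\<close>

definition energy :: "int set \<Rightarrow> nat" where
  "energy Y = card {(y0, y1, y2, y3). y0 \<in> Y \<and> y1 \<in> Y \<and> y2 \<in> Y \<and> y3 \<in> Y \<and> int N dvd y0 + y1 - y2 - y3}"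

text \<open>Writing the fourth power as \<open>(S * cnj S)^2\<close> and expanding, orthogonality in
  \<open>k\<close> keeps exactly the additive quadruples modulo \<open>N\<close>, trivial ones
  included.\<close>

lemma sum_norm4_exponential_sum:
  assumes "finite Y"
  shows "(\<Sum>k\<in>R. cmod (\<Sum>y\<in>Y. e (- (k * y))) ^ 4) = real N * real (energy Y)"
proof -
  let ?S = "\<lambda>k. \<Sum>y\<in>Y. e (- (k * y))"
  let ?P = "\<lambda>y0 y1 y2 y3. int N dvd y0 + y1 - y2 - y3"
  have S4: "complex_of_real (cmod (?S k) ^ 4) =
      (\<Sum>y0\<in>Y. \<Sum>y1\<in>Y. \<Sum>y2\<in>Y. \<Sum>y3\<in>Y. e (- (k * y0)) * e (- (k * y1)) * e (k * y2) * e (k * y3) * 1)" for k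
  proof -
    have "complex_of_real (cmod (?S k) ^ 4) = (complex_of_real (cmod (?S k) ^ 2)) ^ 2"
      by simp
    also have "\<dots> = (?S k * cnj (?S k)) ^ 2"
      by (simp only: complex_norm_square)
    also have "cnj (?S k) = (\<Sum>y\<in>Y. e (k * y))"
      by (simp add: e_minus)
    finally show ?thesis
      unfolding sum_factor4 by (simp add: power2_eq_square algebra_simps)
  qed
  have "complex_of_real (\<Sum>k\<in>R. cmod (?S k) ^ 4) = 
     (\<Sum>y0\<in>Y. \<Sum>y1\<in>Y. \<Sum>y2\<in>Y. \<Sum>y3\<in>Y. \<Sum>k\<in>R. e (- (k * y0)) * e (- (k * y1)) * e (k * y2) * e (k * y3) * 1)"
    unfolding of_real_sum S4 by (rule sum_swap4)
  also have "\<dots> = (\<Sum>y0\<in>Y. \<Sum>y1\<in>Y. \<Sum>y2\<in>Y. \<Sum>y3\<in>Y. if ?P y0 y1 y2 y3 then of_nat N else 0)"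
  proof (intro sum.cong refl)
    fix y0 y1 y2 y3
    have "(\<Sum>k\<in>R. e (- (k * y0)) * e (- (k * y1)) * e (k * y2) * e (k * y3) * 1) =
      (\<Sum>k\<in>R. e (k * (y2 + y3 - y0 - y1)))"
      by (intro sum.cong refl) (simp add: e_add[symmetric] algebra_simps)
    also have "\<dots> = (if ?P y0 y1 y2 y3 then of_nat N else 0)"
    proof -
      have "y2 + y3 - y0 - y1 = - (y0 + y1 - y2 - y3)" by simp
      then show ?thesis unfolding sum_e by (simp only: dvd_minus_iff)
    qed
    finally show "(\<Sum>k\<in>R. e (- (k * y0)) * e (- (k * y1)) * e (k * y2) * e (k * y3) * 1) = \<dots>" .
  qed
  also have "\<dots> = (\<Sum>(y0, y1, y2, y3)\<in>Y \<times> Y \<times> Y \<times> Y. if ?P y0 y1 y2 y3 then of_nat N else 0)"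
    by (simp add: sum.cartesian_product)
  also have "\<dots> = (\<Sum>q\<in>{(y0, y1, y2, y3). y0 \<in> Y \<and> y1 \<in> Y \<and> y2 \<in> Y \<and> y3 \<in> Y \<and> ?P y0 y1 y2 y3}. of_nat N)"
    using assms by (intro sum.mono_neutral_cong_right) (auto split: if_splits)
  also have "\<dots> = of_real (real N * real (energy Y))"
    by (simp add: energy_def)
  finally show ?thesis by (simp only: of_real_eq_iff)
qed

end

section \<open>Counting lemma and near-Sidon sets\<close>

text \<open>Two rounds of the arithmetic-geometric mean inequality for pairs.\<close>

lemma prod4_le_sum_power4:
  fixes p0 p1 p2 p3 :: real
  shows "p0 * p1 * p2 * p3 \<le> (p0 ^ 4 + p1 ^ 4 + p2 ^ 4 + p3 ^ 4) / 4"
proof -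
  have am: "2 * (x * y) \<le> x ^ 2 + y ^ 2" for x y :: real
    using sum_squares_bound[of x y] by simp
  have "2 * ((p0 * p1) * (p2 * p3)) \<le> (p0 * p1) ^ 2 + (p2 * p3) ^ 2" by (rule am)
  moreover have "2 * (p0 ^ 2 * p1 ^ 2) \<le> (p0 ^ 2) ^ 2 + (p1 ^ 2) ^ 2" by (rule am)
  moreover have "2 * (p2 ^ 2 * p3 ^ 2) \<le> (p2 ^ 2) ^ 2 + (p3 ^ 2) ^ 2" by (rule am)
  ultimately show ?thesis by (simp add: power_mult_distrib)
qed

text \<open>An elementary substitute for Hoelder: after telescoping, each term has one small
  difference and four factors bounded by the \<open>cmod (a j)\<close>, and the product of four is
  bounded by fourth powers.\<close>

lemma prod5_diff_le:
  fixes a b :: "nat \<Rightarrow> complex"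
  assumes "\<And>i. i < 5 \<Longrightarrow> cmod (b i) \<le> cmod (a i)" "\<And>i. i < 5 \<Longrightarrow> cmod (a i - b i) \<le> \<tau>"
  shows "cmod (a 0 * a 1 * a 2 * a 3 * a 4 - b 0 * b 1 * b 2 * b 3 * b 4) \<le> \<tau> * (\<Sum>i<5. cmod (a i) ^ 4)"
proof -
  let ?p = "\<lambda>i. cmod (a i)"
  have d: "cmod (a i - b i) \<le> \<tau>" "cmod (b i) \<le> ?p i" if "i < 5" for i
    using assms that by auto
  have \<tau>: "0 \<le> \<tau>" using d(1)[of 0] norm_ge_zero[of "a 0 - b 0"] by linarith
  \<comment> \<open>Replace \<open>a i\<close> by \<open>b i\<close> one index at a time.\<close>
  have "cmod (a 0 * a 1 * a 2 * a 3 * a 4 - b 0 * b 1 * b 2 * b 3 * b 4) =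
    cmod ((a 0 - b 0) * (a 1 * a 2 * a 3 * a 4) + (a 1 - b 1) * (b 0 * a 2 * a 3 * a 4) +
      (a 2 - b 2) * (b 0 * b 1 * a 3 * a 4) + (a 3 - b 3) * (b 0 * b 1 * b 2 * a 4) +
      (a 4 - b 4) * (b 0 * b 1 * b 2 * b 3))"
    by (rule arg_cong[where f = cmod]) (simp add: algebra_simps)
  also have "\<dots> \<le> cmod ((a 0 - b 0) * (a 1 * a 2 * a 3 * a 4)) + cmod ((a 1 - b 1) * (b 0 * a 2 * a 3 * a 4)) +
      cmod ((a 2 - b 2) * (b 0 * b 1 * a 3 * a 4)) + cmod ((a 3 - b 3) * (b 0 * b 1 * b 2 * a 4)) +
      cmod ((a 4 - b 4) * (b 0 * b 1 * b 2 * b 3))"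
    by (intro norm_triangle_le add_mono order_refl)
  also have "\<dots> \<le> \<tau> * (?p 1 * ?p 2 * ?p 3 * ?p 4) + \<tau> * (?p 0 * ?p 2 * ?p 3 * ?p 4) +
      \<tau> * (?p 0 * ?p 1 * ?p 3 * ?p 4) + \<tau> * (?p 0 * ?p 1 * ?p 2 * ?p 4) + \<tau> * (?p 0 * ?p 1 * ?p 2 * ?p 3)"
    unfolding norm_mult using \<tau> by (intro add_mono mult_mono d) auto
  also have "\<dots> = \<tau> * (?p 1 * ?p 2 * ?p 3 * ?p 4 + ?p 0 * ?p 2 * ?p 3 * ?p 4 +
      ?p 0 * ?p 1 * ?p 3 * ?p 4 + ?p 0 * ?p 1 * ?p 2 * ?p 4 + ?p 0 * ?p 1 * ?p 2 * ?p 3)"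
    by (simp add: algebra_simps)
  \<comment> \<open>Each fourth power occurs in four of the five products, with weight
    \<open>1/4\<close> each time, so its total coefficient is one.\<close>
  also have "\<dots> \<le> \<tau> * (\<Sum>i<5. ?p i ^ 4)"
  proof (rule mult_left_mono[OF _ \<tau>])
    have "(\<Sum>i<5. ?p i ^ 4) = ?p 0 ^ 4 + ?p 1 ^ 4 + ?p 2 ^ 4 + ?p 3 ^ 4 + ?p 4 ^ 4"
      by (simp add: eval_nat_numeral)
    then show "?p 1 * ?p 2 * ?p 3 * ?p 4 + ?p 0 * ?p 2 * ?p 3 * ?p 4 +
      ?p 0 * ?p 1 * ?p 3 * ?p 4 + ?p 0 * ?p 1 * ?p 2 * ?p 4 + ?p 0 * ?p 1 * ?p 2 * ?p 3 \<le> (\<Sum>i<5. ?p i ^ 4)"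
      using prod4_le_sum_power4[of "?p 1" "?p 2" "?p 3" "?p 4"] prod4_le_sum_power4[of "?p 0" "?p 2" "?p 3" "?p 4"]
        prod4_le_sum_power4[of "?p 0" "?p 1" "?p 3" "?p 4"] prod4_le_sum_power4[of "?p 0" "?p 1" "?p 2" "?p 4"]
        prod4_le_sum_power4[of "?p 0" "?p 1" "?p 2" "?p 3"] by simp
  qed
  finally show ?thesis .
qed

context cyclic
begin

text \<open>On the Fourier side the difference of the counts is bounded frequency by frequency by
  \<open>prod5_diff_le\<close>; what remains are fourth moments, which additive energy
  controls.\<close>

lemma counting_lemma:
  assumes "periodic (f 4)" "periodic (h 4)"
    and "\<And>i k. i < 5 \<Longrightarrow> cmod (ft (h i) k) \<le> cmod (ft (f i) k)"
    and "\<And>i k. i < 5 \<Longrightarrow> k \<in> R \<Longrightarrow> cmod (ft (f i) k - ft (h i) k) \<le> \<tau>"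
    and "\<And>i. i < 5 \<Longrightarrow> (\<Sum>k\<in>R. cmod (ft (f i) k) ^ 4) \<le> C"
    and \<tau>: "0 \<le> \<tau>"
  shows "\<bar>T f - T h\<bar> \<le> 5 * \<tau> * C"
proof -
  let ?P = "\<lambda>f k. ft (f 0) k * ft (f 1) k * ft (f 2) k * ft (f 3) k * ft (f 4) k"
  have "\<bar>T f - T h\<bar> = cmod (of_real (T f) - of_real (T h))"
    by (metis norm_of_real of_real_diff real_norm_def)
  also have "\<dots> = cmod (\<Sum>k\<in>R. ?P f k - ?P h k)"
    unfolding T_fourier[of f, OF assms(1)] T_fourier[of h, OF assms(2)] sum_subtractf ..
  also have "\<dots> \<le> (\<Sum>k\<in>R. cmod (?P f k - ?P h k))"
    by (rule norm_sum)
  also have "\<dots> \<le> (\<Sum>k\<in>R. \<tau> * (\<Sum>i<5. cmod (ft (f i) k) ^ 4))"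
    by (intro sum_mono prod5_diff_le[of "\<lambda>i. ft (h i) k" "\<lambda>i. ft (f i) k" for k] assms)
  also have "\<dots> = \<tau> * (\<Sum>i<5. \<Sum>k\<in>R. cmod (ft (f i) k) ^ 4)"
    by (simp add: sum_distrib_left sum.swap[of _ "{..<5}"])
  also have "\<dots> \<le> \<tau> * (\<Sum>i<(5::nat). C)"
    by (intro mult_left_mono sum_mono assms) auto
  finally show ?thesis by (simp add: mult_ac)
qed

text \<open>The sets of interest have \<open>O(sqrt N)\<close> elements, so the factor
  \<open>sqrt N\<close> makes the mean of order one. Reducing the argument makes the function
  periodic.\<close>

definition ind :: "int set \<Rightarrow> int \<Rightarrow> real" where
  "ind Y x = sqrt (real N) * of_bool (x mod int N \<in> Y)"

lemma periodic_ind: "periodic (ind Y)"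
  by (simp add: periodic_def ind_def)

lemma ind_nonneg: "0 \<le> ind Y x"
  by (simp add: ind_def)

lemma sum_ind:
  fixes g :: "int \<Rightarrow> 'b::real_vector"
  assumes "Y \<subseteq> R"
  shows "(\<Sum>x\<in>R. ind Y x *\<^sub>R g x) = sqrt (real N) *\<^sub>R (\<Sum>y\<in>Y. g y)"
proof -
  have "(\<Sum>x\<in>R. ind Y x *\<^sub>R g x) = (\<Sum>x\<in>Y. ind Y x *\<^sub>R g x)"
    using assms by (intro sum.mono_neutral_right) (auto simp: ind_def)
  also have "\<dots> = (\<Sum>x\<in>Y. sqrt (real N) *\<^sub>R g x)"
  proof (intro sum.cong refl)
    fix y assume "y \<in> Y"
    then have "y mod int N = y" using assms by auto
    then show "ind Y y *\<^sub>R g y = sqrt (real N) *\<^sub>R g y" using \<open>y \<in> Y\<close> by (simp add: ind_def)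
  qed
  finally show ?thesis by (simp add: scaleR_sum_right)
qed

lemma ft_ind_power4:
  assumes "Y \<subseteq> R"
  shows "(\<Sum>k\<in>R. cmod (ft (ind Y) k) ^ 4) = real (energy Y) / real N"
proof -
  have fin: "finite Y" using assms finite_subset by blast
  have "ft (ind Y) k = of_real (sqrt (real N) / real N) * (\<Sum>y\<in>Y. e (- (k * y)))" for k
    using sum_ind[OF assms, of "\<lambda>y. e (- (k * y))"] by (simp add: ft_def scaleR_conv_of_real)
  then have "cmod (ft (ind Y) k) ^ 4 = (sqrt (real N) / real N) ^ 4 * cmod (\<Sum>y\<in>Y. e (- (k * y))) ^ 4" for k
    by (simp only: norm_mult norm_of_real power_mult_distrib power_even_abs_numeral even_numeral)
  moreover have "(sqrt (real N) / real N) ^ 4 = 1 / real N ^ 2"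
  proof -
    have "sqrt (real N) ^ 4 = (sqrt (real N) ^ 2) ^ 2" by (simp only: power_mult[symmetric]) simp
    then show ?thesis using N_pos by (simp add: power_divide power4_eq_xxxx power2_eq_square)
  qed
  ultimately have "cmod (ft (ind Y) k) ^ 4 = cmod (\<Sum>y\<in>Y. e (- (k * y))) ^ 4 / real N ^ 2" for k
    by simp
  then have "(\<Sum>k\<in>R. cmod (ft (ind Y) k) ^ 4) = real N * real (energy Y) / real N ^ 2"
    by (simp add: sum_norm4_exponential_sum[OF fin] flip: sum_divide_distrib)
  then show ?thesis using N_pos by (simp add: power2_eq_square)
qed

definition nquads :: "int set \<Rightarrow> nat" where
  "nquads Y = card {(y0, y1, y2, y3). y0 \<in> Y \<and> y1 \<in> Y \<and> y2 \<in> Y \<and> y3 \<in> Y \<and> int N dvd y0 + y1 - y2 - y3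
      \<and> \<not> (y0 = y2 \<and> y1 = y3) \<and> \<not> (y0 = y3 \<and> y1 = y2)}"

text \<open>The trivial quadruples form two images of \<open>Y \<times> Y\<close>.\<close>

lemma energy_le:
  assumes "finite Y"
  shows "energy Y \<le> nquads Y + 2 * card Y ^ 2"
proof -
  let ?Q = "{(y0, y1, y2, y3). y0 \<in> Y \<and> y1 \<in> Y \<and> y2 \<in> Y \<and> y3 \<in> Y \<and> int N dvd y0 + y1 - y2 - y3
      \<and> \<not> (y0 = y2 \<and> y1 = y3) \<and> \<not> (y0 = y3 \<and> y1 = y2)}"
  let ?A = "(\<lambda>(x, y). (x, y, x, y)) ` (Y \<times> Y)" and ?B = "(\<lambda>(x, y). (x, y, y, x)) ` (Y \<times> Y)"
  have fQ: "finite ?Q"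
    by (rule finite_subset[of _ "Y \<times> Y \<times> Y \<times> Y"]) (use assms in auto)
  have "energy Y \<le> card (?Q \<union> ?A \<union> ?B)"
    unfolding energy_def by (rule card_mono) (use fQ assms in auto)
  also have "\<dots> \<le> card ?Q + card ?A + card ?B"
    by (meson add_le_mono1 card_Un_le order_trans)
  also have "\<dots> \<le> card ?Q + card (Y \<times> Y) + card (Y \<times> Y)"
    by (intro add_mono card_image_le order_refl) (use assms in auto)
  finally show ?thesis by (simp add: nquads_def card_cartesian_product power2_eq_square)
qed

text \<open>The frequency \<open>k = 0\<close> alone contributes \<open>card Y ^ 4\<close> to the
  fourth moment, while \<open>energy_le\<close> bounds the whole of it by
  \<open>N * (N + 2 * card Y ^ 2)\<close>. Completing the square bounds \<open>card Y ^ 2\<close>,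
  and this feeds back into the energy.\<close>

lemma near_sidon:
  assumes "Y \<subseteq> R" "real (nquads Y) \<le> real N"
  shows "real (card Y) ^ 2 \<le> 3 * real N" "real (energy Y) \<le> 7 * real N"
proof -
  have fin: "finite Y" using assms finite_subset by blast
  let ?c = "real (card Y) ^ 2"
  have en: "real (energy Y) \<le> real N + 2 * ?c"
  proof -
    have "real (energy Y) \<le> real (nquads Y + 2 * card Y ^ 2)"
      using energy_le[OF fin] of_nat_mono by blast
    then show ?thesis using assms(2) by simp
  qed
  have "?c ^ 2 = cmod (\<Sum>y\<in>Y. e (- (0 * y))) ^ 4" by simp
  also have "\<dots> \<le> (\<Sum>k\<in>R. cmod (\<Sum>y\<in>Y. e (- (k * y))) ^ 4)"
    by (rule member_le_sum[of 0]) (use N_pos in auto)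
  also have "\<dots> = real N * real (energy Y)"
    by (rule sum_norm4_exponential_sum[OF fin])
  also have "\<dots> \<le> real N * (real N + 2 * ?c)"
    using en by (intro mult_left_mono) auto
  finally have "?c ^ 2 \<le> real N * (real N + 2 * ?c)" .
  then have "(?c - real N) ^ 2 \<le> 2 * real N ^ 2"
    by (simp add: power2_eq_square algebra_simps)
  also have "\<dots> \<le> (2 * real N) ^ 2" by (simp add: power_mult_distrib)
  finally have "?c - real N \<le> 2 * real N"
    by (rule power2_le_imp_le) simp
  then show "?c \<le> 3 * real N" by simp
  then show "real (energy Y) \<le> 7 * real N" using en by simp
qed

section \<open>Bohr sets\<close>

lemma cmod_e_minus_1: "cmod (e k - 1) \<le> 2 * pi * \<bar>real_of_int k\<bar> / real N"
proof -
  let ?x = "2 * pi * real_of_int k / real N"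
  have "cmod (e k - 1) = 2 * \<bar>sin (?x / 2)\<bar>"
    using dist_exp_i_1[of ?x] by (simp add: e_def cis_conv_exp)
  also have "\<dots> \<le> 2 * \<bar>?x / 2\<bar>"
    by (intro mult_left_mono abs_sin_x_le_abs_x) auto
  also have "\<dots> = 2 * pi * \<bar>real_of_int k\<bar> / real N"
    by (simp add: abs_mult)
  finally show ?thesis .
qed

text \<open>Pigeonhole: at most \<open>K ^ m\<close> cells cover the residues, and the difference of
  two residues in the same cell lies in the Bohr set, so no cell contains more residues than that
  set.\<close>

lemma bohr_set_card:
  assumes fin: "finite \<Lambda>" and card: "card \<Lambda> \<le> m" and K: "K > 0"
  shows "N \<le> K ^ m * card {t \<in> R. (\<Sum>k\<in>\<Lambda>. cmod (e (k * t) - 1)) \<le> 2 * pi * real m / real K}"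
    (is "N \<le> K ^ m * card ?B")
proof -
  \<comment> \<open>The cell of the torus point with coordinates \<open>k * t / N\<close>, when
    every circle is cut into \<open>K\<close> equal arcs.\<close>
  define \<phi> where "\<phi> t = (\<lambda>k\<in>\<Lambda>. (int K * (k * t mod int N)) div int N)" for t
  let ?P = "PiE \<Lambda> (\<lambda>_. {0..<int K})"
  have \<phi>P: "\<phi> t \<in> ?P" for t
  proof (unfold \<phi>_def, rule restrict_PiE_iff[THEN iffD2], rule ballI)
    fix k
    have "0 \<le> k * t mod int N" "k * t mod int N < int N" using N_pos by auto
    then have "0 \<le> int K * (k * t mod int N)" "int K * (k * t mod int N) < int K * int N"
      using K by auto
    moreover have "int K * (k * t mod int N) div int N * int N \<le> int K * (k * t mod int N)"
      using N_pos by (simp add: minus_mod_eq_div_mult[symmetric])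
    ultimately have "int K * (k * t mod int N) div int N * int N < int K * int N" by linarith
    then have "int K * (k * t mod int N) div int N < int K"
      using N_pos by (simp add: mult_less_cancel_right)
    then show "int K * (k * t mod int N) div int N \<in> {0..<int K}"
      using N_pos \<open>0 \<le> int K * (k * t mod int N)\<close> by (simp add: pos_imp_zdiv_nonneg_iff)
  qed
  have finP: "finite ?P" using fin by (intro finite_PiE) auto
  have cP: "card ?P \<le> K ^ m"
    using card K by (simp add: card_PiE[OF fin] power_increasing)
  have fib: "card {t \<in> R. \<phi> t = c} \<le> card ?B" for c
  proof (cases "{t \<in> R. \<phi> t = c} = {}")
    case False
    then obtain t0 where t0: "\<phi> t0 = c" by auto
    show ?thesis
    proof (rule card_inj_on_le)
      show "inj_on (\<lambda>t. (t - t0) mod int N) {t \<in> R. \<phi> t = c}"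
      proof (rule inj_onI)
        fix x y assume x: "x \<in> {t \<in> R. \<phi> t = c}" and y: "y \<in> {t \<in> R. \<phi> t = c}"
          and "(x - t0) mod int N = (y - t0) mod int N"
        then have "(x - t0 + t0) mod int N = (y - t0 + t0) mod int N"
          by (metis mod_add_left_eq)
        then show "x = y" using x y by simp
      qed
      show "finite ?B" by (rule finite_subset[of _ R]) auto
      show "(\<lambda>t. (t - t0) mod int N) ` {t \<in> R. \<phi> t = c} \<subseteq> ?B"
      proof (rule image_subsetI)
        fix t assume "t \<in> {t \<in> R. \<phi> t = c}"
        then have t: "\<phi> t = \<phi> t0" using t0 by simp
        have "cmod (e (k * ((t - t0) mod int N)) - 1) \<le> 2 * pi / real K" if k: "k \<in> \<Lambda>" for k
        proof -
          define u where "u = k * t mod int N"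
          define u0 where "u0 = k * t0 mod int N"
          have "(int K * u) div int N = (int K * u0) div int N"
            using fun_cong[OF t, of k] k by (simp add: \<phi>_def u_def u0_def)
          \<comment> \<open>With equal quotients only the remainders differ, and both lie below
            \<open>N\<close>.\<close>
          then have "int K * u - int K * u0 = (int K * u) mod int N - (int K * u0) mod int N"
            by (metis add_diff_cancel_left div_mult_mod_eq)
          moreover have "0 \<le> (int K * u) mod int N" "(int K * u) mod int N < int N"
            "0 \<le> (int K * u0) mod int N" "(int K * u0) mod int N < int N" using N_pos by auto
          ultimately have "\<bar>int K * (u - u0)\<bar> \<le> int N"
            unfolding right_diff_distrib by linarith
          then have "real_of_int \<bar>int K * (u - u0)\<bar> \<le> real_of_int (int N)"
            by (simp only: of_int_le_iff)
          then have ub: "real K * \<bar>real_of_int (u - u0)\<bar> \<le> real N"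
            by (simp add: abs_mult)
          have "e (k * ((t - t0) mod int N)) = e (u - u0)"
          proof (rule e_cong)
            have "k * ((t - t0) mod int N) - (u - u0) =
                k * ((t - t0) mod int N - (t - t0)) - ((u - k * t) - (u0 - k * t0))"
              by (simp add: algebra_simps)
            also have "int N dvd \<dots>"
              unfolding u_def u0_def by (intro dvd_diff dvd_mult dvd_mod_diff)
            finally show "int N dvd k * ((t - t0) mod int N) - (u - u0)" .
          qed
          then have "cmod (e (k * ((t - t0) mod int N)) - 1) \<le> 2 * pi * \<bar>real_of_int (u - u0)\<bar> / real N"
            using cmod_e_minus_1[of "u - u0"] by simp
          also have "\<dots> \<le> 2 * pi / real K"
            using ub K N_pos by (simp add: field_simps)
          finally show ?thesis .
        qed
        then have "(\<Sum>k\<in>\<Lambda>. cmod (e (k * ((t - t0) mod int N)) - 1)) \<le> real (card \<Lambda>) * (2 * pi / real K)"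
          by (rule sum_bounded_above)
        also have "\<dots> \<le> real m * (2 * pi / real K)"
          using card by (intro mult_right_mono) auto
        finally show "(t - t0) mod int N \<in> ?B"
          using mod_in_R by (simp add: mult_ac)
      qed
    qed
  next
    case True
    then show ?thesis by (simp only: True card.empty)
  qed
  have "N = card (\<Union>c\<in>?P. {t \<in> R. \<phi> t = c})"
  proof -
    have "(\<Union>c\<in>?P. {t \<in> R. \<phi> t = c}) = R" using \<phi>P by auto
    then show ?thesis by simp
  qed
  also have "\<dots> \<le> (\<Sum>c\<in>?P. card {t \<in> R. \<phi> t = c})"
    by (rule card_UN_le[OF finP])
  also have "\<dots> \<le> card ?P * card ?B"
    using sum_bounded_above[of ?P "\<lambda>c. card {t \<in> R. \<phi> t = c}" "card ?B"] fib by simp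
  also have "\<dots> \<le> K ^ m * card ?B"
    using cP by (rule mult_right_mono) simp
  finally show ?thesis .
qed

section \<open>Averaging operators\<close>

lemma periodic_compose:
  assumes "periodic g"
  shows "periodic (\<lambda>x. g (x + t))" "periodic (\<lambda>x. g (t + x))" "periodic (\<lambda>x. g (x - t))" "periodic (\<lambda>x. g (t - x))"
    "periodic (\<lambda>x. g (- x))"
  by (auto simp: periodic_def intro!: periodic_cong[OF assms])

lemma periodic_mult_fun:
  assumes "periodic u" "periodic v"
  shows "periodic (\<lambda>x. u x * v x)"
  using assms by (simp add: periodic_def)

text \<open>Symmetric probability weights modulo \<open>N\<close>; the symmetry makes averaging
  self-adjoint and lets shifts be taken with either sign.\<close>

definition kernel :: "(int \<Rightarrow> real) \<Rightarrow> bool" where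
  "kernel p \<longleftrightarrow> periodic p \<and> (\<forall>s. 0 \<le> p s) \<and> (\<forall>s. p (- s) = p s) \<and> (\<Sum>s\<in>R. p s) = 1"

definition avg :: "(int \<Rightarrow> real) \<Rightarrow> (int \<Rightarrow> real) \<Rightarrow> int \<Rightarrow> real" where
  "avg p g x = (\<Sum>s\<in>R. p s * g (x + s))"

definition ip :: "(int \<Rightarrow> real) \<Rightarrow> (int \<Rightarrow> real) \<Rightarrow> real" where
  "ip u v = (\<Sum>x\<in>R. u x * v x) / real N"

lemma avg_periodic: "periodic g \<Longrightarrow> periodic (avg p g)"
proof -
  assume g: "periodic g"
  have "g (x + int N + s) = g (x + s)" for x s
    by (rule periodic_cong[OF g]) simp
  then show ?thesis by (simp add: periodic_def avg_def)
qed

lemma avg_nonneg: "kernel p \<Longrightarrow> (\<And>x. 0 \<le> g x) \<Longrightarrow> 0 \<le> avg p g x"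
  by (auto simp: avg_def kernel_def intro!: sum_nonneg)

lemma avg_mono: "kernel p \<Longrightarrow> (\<And>x. g x \<le> h x) \<Longrightarrow> avg p g x \<le> avg p h x"
  by (auto simp: avg_def kernel_def intro!: sum_mono mult_left_mono)

lemma avg_alt:
  assumes "kernel p" "periodic g"
  shows "avg p g x = (\<Sum>y\<in>R. p (y - x) * g y)"
proof -
  have "periodic (\<lambda>y. p (y - x) * g y)"
    using assms by (intro periodic_mult_fun periodic_compose) (auto simp: kernel_def)
  from sum_shift[OF this, of x] show ?thesis by (simp add: avg_def add.commute)
qed

lemma avg_minus:
  assumes "kernel p" "periodic g"
  shows "avg p g x = (\<Sum>s\<in>R. p s * g (x - s))"
proof -
  have "periodic (\<lambda>y. p y * g (x - y))"
    using assms by (intro periodic_mult_fun periodic_compose) (auto simp: kernel_def)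
  from sum_minus[OF this, of 0] show ?thesis using assms by (simp add: avg_def kernel_def)
qed

lemma avg_self_adjoint:
  assumes "kernel p" "periodic u" "periodic v"
  shows "ip u (avg p v) = ip (avg p u) v"
proof -
  have sym: "p (y - x) = p (x - y)" for x y
    using assms(1) by (metis kernel_def minus_diff_eq)
  have "(\<Sum>x\<in>R. u x * avg p v x) = (\<Sum>x\<in>R. \<Sum>y\<in>R. u x * (p (y - x) * v y))"
    by (simp add: avg_alt[OF assms(1,3)] sum_distrib_left)
  also have "\<dots> = (\<Sum>y\<in>R. \<Sum>x\<in>R. u x * (p (y - x) * v y))"
    by (rule sum.swap)
  also have "\<dots> = (\<Sum>y\<in>R. avg p u y * v y)"
    unfolding avg_alt[OF assms(1,2)] sum_distrib_right
    by (intro sum.cong refl) (simp add: sym mult_ac)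
  finally show ?thesis by (simp add: ip_def)
qed

lemma avg_const: "kernel p \<Longrightarrow> avg p (\<lambda>_. c) x = c"
  by (simp add: avg_def kernel_def flip: sum_distrib_right)

text \<open>Self-adjointness tested against the constant function one.\<close>

lemma sum_avg:
  assumes "kernel p" "periodic g"
  shows "(\<Sum>x\<in>R. avg p g x) = (\<Sum>x\<in>R. g x)"
  using avg_self_adjoint[OF assms(1) _ assms(2), of "\<lambda>_. 1"] N_pos
  by (simp add: ip_def avg_const[OF assms(1)] periodic_def)

text \<open>The difference of the two sides is a variance under the weights
  \<open>p\<close>.\<close>

lemma avg_square_le:
  assumes "kernel p"
  shows "(avg p g x) ^ 2 \<le> avg p (\<lambda>x. g x ^ 2) x"
proof -
  let ?c = "avg p g x"
  have p: "(\<Sum>s\<in>R. p s) = 1" using assms by (simp add: kernel_def)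
  have "0 \<le> (\<Sum>s\<in>R. p s * (g (x + s) - ?c) ^ 2)"
    using assms by (intro sum_nonneg mult_nonneg_nonneg) (auto simp: kernel_def)
  also have "\<dots> = (\<Sum>s\<in>R. p s * g (x + s) ^ 2 - 2 * ?c * (p s * g (x + s)) + ?c ^ 2 * p s)"
    by (intro sum.cong refl) (simp add: power2_eq_square algebra_simps)
  also have "\<dots> = avg p (\<lambda>x. g x ^ 2) x - 2 * ?c * ?c + ?c ^ 2 * 1"
    unfolding sum.distrib sum_subtractf sum_distrib_left[symmetric] p by (simp add: avg_def)
  finally show ?thesis by (simp add: power2_eq_square)
qed

lemma avg_contraction:
  assumes "kernel p" "periodic g"
  shows "ip (avg p g) (avg p g) \<le> ip g g"
proof -
  have "(\<Sum>x\<in>R. avg p g x * avg p g x) \<le> (\<Sum>x\<in>R. avg p (\<lambda>x. g x ^ 2) x)"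
    using avg_square_le[OF assms(1)] by (intro sum_mono) (simp add: power2_eq_square)
  also have "\<dots> = (\<Sum>x\<in>R. g x ^ 2)"
    using assms by (intro sum_avg) (auto simp: periodic_def)
  finally show ?thesis by (simp add: ip_def divide_right_mono power2_eq_square)
qed

lemma ip_cauchy_schwarz: "(ip u v) ^ 2 \<le> ip u u * ip v v"
proof -
  have "(\<Sum>x\<in>R. u x * v x) ^ 2 \<le> (\<Sum>x\<in>R. u x * u x) * (\<Sum>x\<in>R. v x * v x)"
    using Cauchy_Schwarz_ineq_sum[of u v R] by (simp add: power2_eq_square)
  then show ?thesis
    by (simp add: ip_def power_divide divide_right_mono power2_eq_square)
qed

section \<open>Averaging as a Fourier multiplier\<close>

definition pt :: "(int \<Rightarrow> real) \<Rightarrow> int \<Rightarrow> complex" where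
  "pt p k = (\<Sum>s\<in>R. of_real (p s) * e (k * s))"

lemma ft_avg:
  assumes "periodic g"
  shows "ft (avg p g) k = ft g k * pt p k"
proof -
  have shift: "(\<Sum>x\<in>R. of_real (g (x + s)) * e (- (k * (x + s)))) = of_nat N * ft g k" for s
  proof -
    have "periodic (\<lambda>x. of_real (g x) * e (- (k * x)))"
      using assms periodic_e(1)[of "- k"] by (simp add: periodic_def)
    from sum_shift[OF this, of s] show ?thesis using N_pos by (simp add: ft_def)
  qed
  have "(\<Sum>x\<in>R. of_real (avg p g x) * e (- (k * x))) =
      (\<Sum>x\<in>R. \<Sum>s\<in>R. of_real (p s) * e (k * s) * (of_real (g (x + s)) * e (- (k * (x + s)))))"
    unfolding avg_def of_real_sum sum_distrib_right
  proof (intro sum.cong refl)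
    fix x s
    have "e (- (k * x)) = e (k * s) * e (- (k * (x + s)))"
      by (simp add: e_add[symmetric] algebra_simps)
    then show "of_real (p s * g (x + s)) * e (- (k * x)) =
      of_real (p s) * e (k * s) * (of_real (g (x + s)) * e (- (k * (x + s))))"
      by simp
  qed
  also have "\<dots> = (\<Sum>s\<in>R. \<Sum>x\<in>R. of_real (p s) * e (k * s) * (of_real (g (x + s)) * e (- (k * (x + s)))))"
    by (rule sum.swap)
  also have "\<dots> = (\<Sum>s\<in>R. of_real (p s) * e (k * s) * (of_nat N * ft g k))"
    unfolding sum_distrib_left[symmetric] shift ..
  also have "\<dots> = of_nat N * ft g k * pt p k"
    by (simp add: pt_def sum_distrib_left mult_ac)
  finally show ?thesis using N_pos by (simp add: ft_def[of "avg p g"])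
qed

lemma cmod_pt_le: "kernel p \<Longrightarrow> cmod (pt p k) \<le> 1"
proof -
  assume p: "kernel p"
  have "cmod (pt p k) \<le> (\<Sum>s\<in>R. cmod (of_real (p s) * e (k * s)))"
    unfolding pt_def by (rule norm_sum)
  also have "\<dots> = 1" using p by (simp add: norm_mult kernel_def)
  finally show ?thesis .
qed

end

section \<open>Smoothing over Bohr sets of the large spectrum\<close>

text \<open>Five functions, each with fourth moment at most 7, give at most
  \<open>35 / \<eta> ^ 4\<close> frequencies above \<open>\<eta>\<close>.\<close>

definition spec_size :: "real \<Rightarrow> nat" where
  "spec_size \<eta> = nat \<lceil>35 / \<eta> ^ 4\<rceil>"

text \<open>The first factor inside the power is the number of cells per frequency in the pigeonhole
  argument for Bohr sets, chosen so that the sum of the \<open>spec_size \<eta>\<close> phases stays below \<open>\<eta> / 2\<close>.\<close>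

definition dens :: "real \<Rightarrow> real" where
  "dens \<eta> = 2 * real ((nat \<lceil>4 * pi * real (spec_size \<eta>) / \<eta>\<rceil> + 1) ^ spec_size \<eta>)"

lemma dens_ge_1: "1 \<le> dens \<eta>"
proof -
  have "1 \<le> real ((nat \<lceil>4 * pi * real (spec_size \<eta>) / \<eta>\<rceil> + 1) ^ spec_size \<eta>)"
    by (simp add: one_le_power)
  then show ?thesis unfolding dens_def by linarith
qed

text \<open>Abstracts the properties of the normalised indicators on which smoothing relies; the
  constants 2 and 7 are those that \<open>near_sidon\<close> provides.\<close>

locale scales = cyclic +
  fixes f :: "nat \<Rightarrow> int \<Rightarrow> real"
  assumes f_periodic: "i < 5 \<Longrightarrow> periodic (f i)"
    and f_nonneg: "i < 5 \<Longrightarrow> 0 \<le> f i x"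
    and f_sum: "i < 5 \<Longrightarrow> (\<Sum>x\<in>R. f i x) \<le> 2 * real N"
    and f_ft4: "i < 5 \<Longrightarrow> (\<Sum>k\<in>R. cmod (ft (f i) k) ^ 4) \<le> 7"
begin

text \<open>One spectrum shared by all five functions, so that a single kernel smooths all of
  them.\<close>

definition Lam :: "real \<Rightarrow> int set" where
  "Lam \<eta> = {k \<in> R. \<exists>i<5. cmod (ft (f i) k) > \<eta>}"

definition bohr_norm :: "real \<Rightarrow> int \<Rightarrow> real" where
  "bohr_norm \<eta> t = (\<Sum>k\<in>Lam \<eta>. cmod (e (k * t) - 1))"

text \<open>The tent shape makes the kernel Lipschitz with respect to \<open>bohr_norm\<close>, so that no regularity
  of the Bohr radius is needed.\<close>

definition bohr_weight :: "real \<Rightarrow> int \<Rightarrow> real" where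
  "bohr_weight \<eta> t = max 0 (1 - bohr_norm \<eta> t / \<eta>)"

definition ker :: "real \<Rightarrow> int \<Rightarrow> real" where
  "ker \<eta> t = bohr_weight \<eta> t / (\<Sum>s\<in>R. bohr_weight \<eta> s)"

abbreviation A :: "real \<Rightarrow> (int \<Rightarrow> real) \<Rightarrow> int \<Rightarrow> real" where
  "A \<eta> \<equiv> avg (ker \<eta>)"

lemma finite_Lam: "finite (Lam \<eta>)"
  by (rule finite_subset[of _ R]) (auto simp: Lam_def)

text \<open>Markov's inequality for the fourth moments.\<close>

lemma card_Lam:
  assumes "\<eta> > 0"
  shows "card (Lam \<eta>) \<le> spec_size \<eta>"
proof -
  have "real (card (Lam \<eta>)) * \<eta> ^ 4 = (\<Sum>k\<in>Lam \<eta>. \<eta> ^ 4)" by simp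
  also have "\<dots> \<le> (\<Sum>k\<in>Lam \<eta>. \<Sum>i<5. cmod (ft (f i) k) ^ 4)"
  proof (rule sum_mono)
    fix k assume "k \<in> Lam \<eta>"
    then obtain i where i: "i < 5" "cmod (ft (f i) k) > \<eta>" by (auto simp: Lam_def)
    then have "\<eta> ^ 4 \<le> cmod (ft (f i) k) ^ 4" using assms by (intro power_mono) auto
    also have "\<dots> \<le> (\<Sum>i<5. cmod (ft (f i) k) ^ 4)"
      using i by (intro member_le_sum[of i]) auto
    finally show "\<eta> ^ 4 \<le> (\<Sum>i<5. cmod (ft (f i) k) ^ 4)" .
  qed
  also have "\<dots> \<le> (\<Sum>k\<in>R. \<Sum>i<5. cmod (ft (f i) k) ^ 4)"
    by (intro sum_mono2 sum_nonneg) (auto simp: Lam_def)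
  also have "\<dots> = (\<Sum>i<5. \<Sum>k\<in>R. cmod (ft (f i) k) ^ 4)"
    by (rule sum.swap)
  also have "\<dots> \<le> (\<Sum>i<(5::nat). 7)"
    by (intro sum_mono f_ft4) auto
  finally have "real (card (Lam \<eta>)) \<le> 35 / \<eta> ^ 4"
    using assms by (simp add: field_simps)
  then show ?thesis unfolding spec_size_def by linarith
qed

lemma bohr_norm_nonneg: "0 \<le> bohr_norm \<eta> t"
  by (simp add: bohr_norm_def sum_nonneg)

lemma bohr_norm_minus: "bohr_norm \<eta> (- t) = bohr_norm \<eta> t"
proof -
  have "cmod (e (k * - t) - 1) = cmod (e (k * t) - 1)" for k
    by (metis complex_cnj_diff complex_cnj_one complex_mod_cnj e_minus mult_minus_right)
  then show ?thesis unfolding bohr_norm_def by simp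
qed

lemma bohr_norm_add: "bohr_norm \<eta> (s + t) \<le> bohr_norm \<eta> s + bohr_norm \<eta> t"
  unfolding bohr_norm_def sum.distrib[symmetric]
proof (rule sum_mono)
  fix k
  have "e (k * (s + t)) - 1 = (e (k * s) - 1) * e (k * t) + (e (k * t) - 1)"
    by (simp add: e_add algebra_simps)
  also have "cmod \<dots> \<le> cmod ((e (k * s) - 1) * e (k * t)) + cmod (e (k * t) - 1)"
    by (rule norm_triangle_ineq)
  finally show "cmod (e (k * (s + t)) - 1) \<le> cmod (e (k * s) - 1) + cmod (e (k * t) - 1)"
    by (simp add: norm_mult)
qed

text \<open>Lowering the threshold enlarges the spectrum over which the norm is summed.\<close>

lemma bohr_norm_antimono: "\<eta>' \<le> \<eta> \<Longrightarrow> bohr_norm \<eta> t \<le> bohr_norm \<eta>' t"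
  unfolding bohr_norm_def by (rule sum_mono2[OF finite_Lam]) (auto simp: Lam_def)

lemma bohr_norm_periodic: "periodic (bohr_norm \<eta>)"
  using periodic_e(1) by (auto simp: periodic_def bohr_norm_def)

lemma bohr_weight_periodic: "periodic (bohr_weight \<eta>)"
  using bohr_norm_periodic by (simp add: periodic_def bohr_weight_def)

lemma bohr_weight_bounds: "0 \<le> bohr_weight \<eta> t" "\<eta> > 0 \<Longrightarrow> bohr_weight \<eta> t \<le> 1"
  by (auto simp: bohr_weight_def bohr_norm_nonneg)

text \<open>The weight is at least \<open>1/2\<close> on the Bohr set of radius
  \<open>\<eta> / 2\<close>, whose size \<open>bohr_set_card\<close> bounds below; this accounts for
  the factor 2 in \<open>dens\<close>.\<close>

lemma sum_bohr_weight_ge: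
  assumes "\<eta> > 0"
  shows "real N / dens \<eta> \<le> (\<Sum>s\<in>R. bohr_weight \<eta> s)"
proof -
  define m where "m = spec_size \<eta>"
  define K where "K = nat \<lceil>4 * pi * real m / \<eta>\<rceil> + 1"
  let ?B = "{t \<in> R. bohr_norm \<eta> t \<le> 2 * pi * real m / real K}"
  have "N \<le> K ^ m * card ?B"
    using bohr_set_card[OF finite_Lam card_Lam[OF assms], of K] by (simp add: m_def K_def bohr_norm_def)
  then have "real N \<le> real (K ^ m) * real (card ?B)"
    by (metis of_nat_le_iff of_nat_mult)
  also have "\<dots> = dens \<eta> * (real (card ?B) * (1 / 2))"
    by (simp add: dens_def m_def K_def)
  finally have "real N / dens \<eta> \<le> real (card ?B) * (1 / 2)"
    using dens_ge_1[of \<eta>] by (simp add: field_simps)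
  also have "\<dots> = (\<Sum>t\<in>?B. 1 / 2)" by simp
  also have "\<dots> \<le> (\<Sum>t\<in>?B. bohr_weight \<eta> t)"
  proof (rule sum_mono)
    fix t assume "t \<in> ?B"
    then have "bohr_norm \<eta> t \<le> 2 * pi * real m / real K" by simp
    moreover have "2 * pi * real m / real K \<le> \<eta> / 2"
    proof -
      have "4 * pi * real m / \<eta> \<le> real K" unfolding K_def by linarith
      then have "4 * pi * real m \<le> real K * \<eta>" using assms by (simp add: pos_divide_le_eq)
      moreover have "0 < real K" by (simp add: K_def)
      ultimately show ?thesis by (simp add: pos_divide_le_eq algebra_simps)
    qed
    ultimately have "bohr_norm \<eta> t \<le> \<eta> / 2" by linarith
    then have "bohr_norm \<eta> t / \<eta> \<le> 1 / 2" using assms by (simp add: field_simps)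
    then show "1 / 2 \<le> bohr_weight \<eta> t" unfolding bohr_weight_def by linarith
  qed
  also have "\<dots> \<le> (\<Sum>s\<in>R. bohr_weight \<eta> s)"
    by (rule sum_mono2) (auto simp: bohr_weight_bounds)
  finally show ?thesis .
qed

lemma sum_bohr_weight_pos: "\<eta> > 0 \<Longrightarrow> 0 < (\<Sum>s\<in>R. bohr_weight \<eta> s)"
proof -
  assume "\<eta> > 0"
  have "0 < real N / dens \<eta>" using N_pos dens_ge_1[of \<eta>] by simp
  then show ?thesis using sum_bohr_weight_ge[OF \<open>\<eta> > 0\<close>] by linarith
qed

lemma kernel_ker: "\<eta> > 0 \<Longrightarrow> kernel (ker \<eta>)"
proof -
  assume "\<eta> > 0"
  then have W: "0 < (\<Sum>s\<in>R. bohr_weight \<eta> s)" by (rule sum_bohr_weight_pos)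
  have "bohr_weight \<eta> (- s) = bohr_weight \<eta> s" for s by (simp add: bohr_weight_def bohr_norm_minus)
  moreover have "(\<Sum>s\<in>R. ker \<eta> s) = 1"
    using W unfolding ker_def sum_divide_distrib[symmetric] by simp
  ultimately show ?thesis
    using bohr_weight_periodic[of \<eta>] W bohr_weight_bounds(1)[of \<eta>]
    by (simp add: kernel_def ker_def periodic_def)
qed

lemma div_sum_bohr_weight_le:
  assumes "\<eta> > 0" "0 \<le> c"
  shows "c / (\<Sum>s\<in>R. bohr_weight \<eta> s) \<le> c * dens \<eta> / real N"
proof -
  have "c / (\<Sum>s\<in>R. bohr_weight \<eta> s) \<le> c / (real N / dens \<eta>)"
    using sum_bohr_weight_ge[OF assms(1)] sum_bohr_weight_pos[OF assms(1)] assms(2) N_pos dens_ge_1[of \<eta>]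
    by (intro divide_left_mono mult_pos_pos divide_pos_pos) auto
  then show ?thesis by simp
qed

lemma ker_le: "\<eta> > 0 \<Longrightarrow> ker \<eta> t \<le> dens \<eta> / real N"
proof -
  assume \<eta>: "\<eta> > 0"
  have "ker \<eta> t \<le> 1 / (\<Sum>s\<in>R. bohr_weight \<eta> s)"
    unfolding ker_def using sum_bohr_weight_pos[OF \<eta>] bohr_weight_bounds(2)[OF \<eta>] by (intro divide_right_mono) auto
  also have "\<dots> \<le> dens \<eta> / real N" using div_sum_bohr_weight_le[OF \<eta>, of 1] by simp
  finally show ?thesis .
qed

lemma ker_support: "\<eta> > 0 \<Longrightarrow> ker \<eta> s \<noteq> 0 \<Longrightarrow> bohr_norm \<eta> s \<le> \<eta>"
  by (auto simp: ker_def bohr_weight_def max_def field_simps split: if_splits)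

text \<open>The tent is Lipschitz in the subadditive \<open>bohr_norm\<close>, and normalising costs
  at most \<open>dens \<eta> / N\<close>. The shift is measured at the finer scale, whose norm
  dominates the coarser one.\<close>

lemma ker_lipschitz:
  assumes "0 < \<eta>'" "\<eta>' \<le> \<eta>" "bohr_norm \<eta>' s \<le> \<eta>'"
  shows "\<bar>ker \<eta> (t + s) - ker \<eta> t\<bar> \<le> (\<eta>' / \<eta>) * dens \<eta> / real N"
proof -
  have \<eta>: "\<eta> > 0" using assms by simp
  have s: "bohr_norm \<eta> s \<le> \<eta>'" using bohr_norm_antimono[OF assms(2), of s] assms(3) by linarith
  have "bohr_norm \<eta> (t + s) \<le> bohr_norm \<eta> t + bohr_norm \<eta> s" by (rule bohr_norm_add)
  moreover have "bohr_norm \<eta> t \<le> bohr_norm \<eta> (t + s) + bohr_norm \<eta> s"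
    using bohr_norm_add[of \<eta> "t + s" "- s"] by (simp add: bohr_norm_minus)
  ultimately have "\<bar>bohr_norm \<eta> (t + s) - bohr_norm \<eta> t\<bar> \<le> \<eta>'" using s by linarith
  then have "\<bar>bohr_norm \<eta> (t + s) / \<eta> - bohr_norm \<eta> t / \<eta>\<bar> \<le> \<eta>' / \<eta>"
    using \<eta> by (simp add: diff_divide_distrib[symmetric] divide_right_mono)
  then have "\<bar>bohr_weight \<eta> (t + s) - bohr_weight \<eta> t\<bar> \<le> \<eta>' / \<eta>"
    unfolding bohr_weight_def by linarith
  then have "\<bar>ker \<eta> (t + s) - ker \<eta> t\<bar> \<le> (\<eta>' / \<eta>) / (\<Sum>s\<in>R. bohr_weight \<eta> s)"
    using sum_bohr_weight_pos[OF \<eta>] unfolding ker_def diff_divide_distrib[symmetric] abs_divide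
    by (simp only: abs_of_pos) (intro divide_right_mono, auto)
  also have "\<dots> \<le> (\<eta>' / \<eta>) * dens \<eta> / real N"
    using assms(1) \<eta> by (intro div_sum_bohr_weight_le) auto
  finally show ?thesis .
qed

text \<open>The shift is moved from \<open>g\<close> onto the kernel, so no regularity of
  \<open>g\<close> is required, only its mean, bounded by 2.\<close>

lemma A_lipschitz:
  assumes "0 < \<eta>'" "\<eta>' \<le> \<eta>" "bohr_norm \<eta>' s \<le> \<eta>'"
    and g: "periodic g" "\<And>x. 0 \<le> g x" "(\<Sum>x\<in>R. g x) \<le> 2 * real N"
  shows "\<bar>A \<eta> g (x + s) - A \<eta> g x\<bar> \<le> 2 * dens \<eta> * \<eta>' / \<eta>"
proof -
  have \<eta>: "\<eta> > 0" using assms by simp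
  let ?c = "(\<eta>' / \<eta>) * dens \<eta> / real N"
  have c: "0 \<le> ?c" using assms(1) \<eta> dens_ge_1[of \<eta>] by simp
  have "\<bar>A \<eta> g (x + s) - A \<eta> g x\<bar> = \<bar>\<Sum>y\<in>R. (ker \<eta> (y - (x + s)) - ker \<eta> (y - x)) * g y\<bar>"
    unfolding avg_alt[OF kernel_ker[OF \<eta>] g(1)] by (simp add: left_diff_distrib sum_subtractf)
  also have "\<dots> \<le> (\<Sum>y\<in>R. ?c * g y)"
  proof (rule order_trans[OF sum_abs sum_mono])
    fix y
    have "bohr_norm \<eta>' (- s) \<le> \<eta>'" using assms(3) by (simp add: bohr_norm_minus)
    from ker_lipschitz[OF assms(1,2) this, of "y - x"]
    have "\<bar>ker \<eta> (y - (x + s)) - ker \<eta> (y - x)\<bar> \<le> ?c" by (simp add: algebra_simps)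
    then show "\<bar>(ker \<eta> (y - (x + s)) - ker \<eta> (y - x)) * g y\<bar> \<le> ?c * g y"
      unfolding abs_mult using g(2)[of y] by (metis abs_of_nonneg mult_right_mono)
  qed
  also have "\<dots> \<le> ?c * (2 * real N)"
    unfolding sum_distrib_left[symmetric] using g(3) c by (rule mult_left_mono)
  also have "\<dots> = 2 * dens \<eta> * \<eta>' / \<eta>" using N_pos by simp
  finally show ?thesis .
qed

text \<open>Only shifts in the support of the kernel contribute to the average.\<close>

lemma A_close:
  assumes "0 < \<eta>" "\<And>x s. bohr_norm \<eta> s \<le> \<eta> \<Longrightarrow> \<bar>g (x + s) - g x\<bar> \<le> c"
  shows "\<bar>A \<eta> g x - g x\<bar> \<le> c"
proof -
  have k: "kernel (ker \<eta>)" using kernel_ker[OF assms(1)] .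
  have "A \<eta> g x - g x = A \<eta> g x - A \<eta> (\<lambda>_. g x) x" by (simp add: avg_const[OF k])
  also have "\<dots> = (\<Sum>s\<in>R. ker \<eta> s * (g (x + s) - g x))"
    by (simp add: avg_def right_diff_distrib sum_subtractf)
  also have "\<bar>\<dots>\<bar> \<le> (\<Sum>s\<in>R. ker \<eta> s * c)"
  proof (rule order_trans[OF sum_abs sum_mono])
    fix s
    have "0 \<le> ker \<eta> s" using k by (simp add: kernel_def)
    then show "\<bar>ker \<eta> s * (g (x + s) - g x)\<bar> \<le> ker \<eta> s * c"
      using assms(2)[of s x] ker_support[OF assms(1), of s]
      by (cases "ker \<eta> s = 0") (auto simp: abs_mult intro!: mult_left_mono)
  qed
  also have "\<dots> = c" using k by (simp add: kernel_def flip: sum_distrib_right)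
  finally show ?thesis .
qed

lemma cmod_ft_le: "i < 5 \<Longrightarrow> cmod (ft (f i) k) \<le> 2"
proof -
  assume i: "i < 5"
  have "cmod (\<Sum>x\<in>R. of_real (f i x) * e (- (k * x))) \<le> (\<Sum>x\<in>R. cmod (of_real (f i x) * e (- (k * x))))"
    by (rule norm_sum)
  also have "\<dots> = (\<Sum>x\<in>R. f i x)"
    using f_nonneg[OF i] by (simp add: norm_mult)
  also have "\<dots> \<le> 2 * real N" by (rule f_sum[OF i])
  finally show ?thesis using N_pos by (simp add: ft_def norm_divide field_simps)
qed

text \<open>A dichotomy: on the spectrum the multiplier is within \<open>\<eta>\<close> of one and
  the transform is at most 2; off it the transform is at most \<open>\<eta>\<close> and the
  multiplier is within 2 of one.\<close>

lemma ft_spectral: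
  assumes "0 < \<eta>" "i < 5" "k \<in> R"
  shows "cmod (ft (f i) k) * cmod (1 - pt (ker \<eta>) k) \<le> 2 * \<eta>"
proof (cases "k \<in> Lam \<eta>")
  case True
  have ke: "kernel (ker \<eta>)" using kernel_ker[OF assms(1)] .
  have "1 - pt (ker \<eta>) k = (\<Sum>s\<in>R. of_real (ker \<eta> s)) - pt (ker \<eta>) k"
    using ke by (simp add: kernel_def flip: of_real_sum)
  also have "\<dots> = (\<Sum>s\<in>R. of_real (ker \<eta> s) * (1 - e (k * s)))"
    by (simp add: pt_def right_diff_distrib sum_subtractf)
  also have "cmod \<dots> \<le> (\<Sum>s\<in>R. ker \<eta> s * \<eta>)"
  proof (rule order_trans[OF norm_sum sum_mono])
    fix s
    have p: "0 \<le> ker \<eta> s" using ke by (simp add: kernel_def)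
    show "cmod (of_real (ker \<eta> s) * (1 - e (k * s))) \<le> ker \<eta> s * \<eta>"
    proof (cases "ker \<eta> s = 0")
      case False
      have "cmod (1 - e (k * s)) = cmod (e (k * s) - 1)" by (rule norm_minus_commute)
      also have "\<dots> \<le> bohr_norm \<eta> s"
        unfolding bohr_norm_def using True finite_Lam by (intro member_le_sum[of k]) auto
      also have "\<dots> \<le> \<eta>" using ker_support[OF assms(1) False] .
      finally show ?thesis using p by (simp add: norm_mult mult_left_mono)
    qed simp
  qed
  also have "\<dots> = \<eta>" using ke by (simp add: kernel_def flip: sum_distrib_right)
  finally have "cmod (1 - pt (ker \<eta>) k) \<le> \<eta>" .
  then show ?thesis using cmod_ft_le[OF assms(2)] by (intro mult_mono) auto
next
  case False
  then have "cmod (ft (f i) k) \<le> \<eta>" using assms by (force simp: Lam_def)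
  moreover have "cmod (1 - pt (ker \<eta>) k) \<le> 2"
    using norm_triangle_ineq4[of 1 "pt (ker \<eta>) k"] cmod_pt_le[OF kernel_ker[OF assms(1)], of k] by simp
  ultimately have "cmod (ft (f i) k) * cmod (1 - pt (ker \<eta>) k) \<le> \<eta> * 2"
    using assms by (intro mult_mono) auto
  then show ?thesis by simp
qed

text \<open>Averaging twice makes the multiplier a square, which yields the monotonicity of the energy.\<close>

definition smooth :: "real \<Rightarrow> nat \<Rightarrow> int \<Rightarrow> real" where
  "smooth \<eta> i = A \<eta> (A \<eta> (f i))"

lemma smooth_periodic: "i < 5 \<Longrightarrow> periodic (smooth \<eta> i)"
  unfolding smooth_def by (intro avg_periodic f_periodic)

lemma smooth_nonneg: "0 < \<eta> \<Longrightarrow> i < 5 \<Longrightarrow> 0 \<le> smooth \<eta> i x"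
  unfolding smooth_def by (intro avg_nonneg kernel_ker f_nonneg)

text \<open>Smoothing moves each transform by at most \<open>4 * \<eta>\<close> and never enlarges
  it, so \<open>counting_lemma\<close> gives \<open>5 * 4 * 7 = 140\<close> times
  \<open>\<eta>\<close>.\<close>

lemma T_smooth:
  assumes "0 < \<eta>"
  shows "\<bar>T f - T (smooth \<eta>)\<bar> \<le> 140 * \<eta>"
proof -
  let ?p = "pt (ker \<eta>)"
  have ft_smooth: "ft (smooth \<eta> i) k = ft (f i) k * ?p k * ?p k" if "i < 5" for i k
    unfolding smooth_def using that by (simp add: ft_avg avg_periodic f_periodic)
  have p1: "cmod (?p k) \<le> 1" for k using cmod_pt_le[OF kernel_ker[OF assms]] .
  have "\<bar>T f - T (smooth \<eta>)\<bar> \<le> 5 * (4 * \<eta>) * 7"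
  proof (rule counting_lemma)
    fix i k assume i: "i < (5::nat)"
    have "cmod (?p k) * cmod (?p k) \<le> 1 * 1" using p1 by (intro mult_mono) auto
    then show "cmod (ft (smooth \<eta> i) k) \<le> cmod (ft (f i) k)"
      unfolding ft_smooth[OF i] norm_mult mult.assoc by (simp add: mult_left_le)
    assume k: "k \<in> R"
    \<comment> \<open>Factoring \<open>1 - p^2\<close> reduces the double average to the bound for a
      single one.\<close>
    have "ft (f i) k - ft (smooth \<eta> i) k = ft (f i) k * (1 - ?p k) * (1 + ?p k)"
      unfolding ft_smooth[OF i] by (simp add: algebra_simps)
    then have "cmod (ft (f i) k - ft (smooth \<eta> i) k) = cmod (ft (f i) k) * cmod (1 - ?p k) * cmod (1 + ?p k)"
      by (simp add: norm_mult)
    also have "\<dots> \<le> 2 * \<eta> * 2"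
    proof (rule mult_mono[OF ft_spectral[OF assms i k]])
      show "cmod (1 + ?p k) \<le> 2" using norm_triangle_ineq[of 1 "?p k"] p1[of k] by simp
    qed (use assms in auto)
    finally show "cmod (ft (f i) k - ft (smooth \<eta> i) k) \<le> 4 * \<eta>" by simp
  qed (use assms f_periodic smooth_periodic f_ft4 in auto)
  then show ?thesis by simp
qed

end

section \<open>Energy of smoothed near-Sidon sets\<close>

text \<open>If the errors sum to at most \<open>\<kappa> / 4\<close>, every factor is at least
  \<open>\<kappa> / 4\<close>; otherwise the left side is not positive. The bound is linear in the
  errors so that it can be averaged over perturbations.\<close>

lemma prod5_ge:
  fixes u0 u1 u2 u3 u4 d0 d1 d2 d3 d4 \<kappa> :: real
  assumes "\<kappa> > 0" "0 \<le> u0" "0 \<le> u1" "0 \<le> u2" "0 \<le> u3" "0 \<le> u4"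
    and "0 \<le> d0" "0 \<le> d1" "0 \<le> d2" "0 \<le> d3" "0 \<le> d4"
    and "\<kappa> / 2 - d0 \<le> u0" "\<kappa> / 2 - d1 \<le> u1" "\<kappa> / 2 - d2 \<le> u2" "\<kappa> / 2 - d3 \<le> u3" "\<kappa> / 2 - d4 \<le> u4"
  shows "(\<kappa> / 4) ^ 5 * (1 - 4 / \<kappa> * (d0 + d1 + d2 + d3 + d4)) \<le> u0 * u1 * u2 * u3 * u4"
proof (cases "d0 + d1 + d2 + d3 + d4 \<le> \<kappa> / 4")
  case True
  have "(\<kappa> / 4) ^ 5 * (1 - 4 / \<kappa> * (d0 + d1 + d2 + d3 + d4)) \<le> (\<kappa> / 4) ^ 5 * 1"
    using assms(1,7-11) by (intro mult_left_mono) auto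
  also have "\<dots> = \<kappa> / 4 * (\<kappa> / 4) * (\<kappa> / 4) * (\<kappa> / 4) * (\<kappa> / 4)"
    by (simp add: eval_nat_numeral)
  also have "\<dots> \<le> u0 * u1 * u2 * u3 * u4"
    using assms True by (intro mult_mono mult_nonneg_nonneg) auto
  finally show ?thesis .
next
  case False
  then have "1 - 4 / \<kappa> * (d0 + d1 + d2 + d3 + d4) \<le> 0"
    using assms(1) by (simp add: field_simps)
  then have "(\<kappa> / 4) ^ 5 * (1 - 4 / \<kappa> * (d0 + d1 + d2 + d3 + d4)) \<le> 0"
    using assms(1) by (intro mult_nonneg_nonpos) auto
  also have "0 \<le> u0 * u1 * u2 * u3 * u4" using assms by simp
  finally show ?thesis .
qed

context cyclic
begin

lemma avg_diff_le:
  assumes "kernel p" "\<And>x. \<bar>u x - v x\<bar> \<le> c"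
  shows "\<bar>avg p u x - avg p v x\<bar> \<le> c"
proof -
  have "\<bar>avg p u x - avg p v x\<bar> = \<bar>\<Sum>s\<in>R. p s * (u (x + s) - v (x + s))\<bar>"
    by (simp add: avg_def right_diff_distrib sum_subtractf)
  also have "\<dots> \<le> (\<Sum>s\<in>R. p s * c)"
  proof (rule order_trans[OF sum_abs sum_mono])
    fix s
    have "0 \<le> p s" using assms(1) by (simp add: kernel_def)
    then show "\<bar>p s * (u (x + s) - v (x + s))\<bar> \<le> p s * c"
      using assms(2)[of "x + s"] by (simp add: abs_mult mult_left_mono)
  qed
  also have "\<dots> = c" using assms(1) by (simp add: kernel_def flip: sum_distrib_right)
  finally show ?thesis .
qed

lemma ip_mono: "(\<And>x. 0 \<le> u x) \<Longrightarrow> (\<And>x. v x \<le> v' x) \<Longrightarrow> ip u v \<le> ip u v'"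
  unfolding ip_def by (intro divide_right_mono sum_mono mult_left_mono) auto

lemma ip_nonneg: "(\<And>x. 0 \<le> u x) \<Longrightarrow> (\<And>x. 0 \<le> v x) \<Longrightarrow> 0 \<le> ip u v"
  unfolding ip_def by (intro divide_nonneg_nonneg sum_nonneg mult_nonneg_nonneg) auto

text \<open>With \<open>g'\<close> the restriction of \<open>g\<close> to the low set and \<open>m\<close> its mean, self-adjointness and
  Cauchy-Schwarz give \<open>m^2 \<le> |avg p g'|^2 \<le> \<langle>g', avg p (avg p g)\<rangle> \<le> \<kappa> m\<close>.\<close>

lemma low_mass:
  assumes p: "kernel p" and g: "periodic g" "\<And>x. 0 \<le> g x" and \<kappa>: "0 < \<kappa>"
  shows "ip g (\<lambda>x. of_bool (avg p (avg p g) x < \<kappa>)) \<le> \<kappa>"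
proof -
  define h where "h = avg p (avg p g)"
  define g' where "g' x = g x * of_bool (h x < \<kappa>)" for x
  define m where "m = ip g' (\<lambda>_. 1)"
  have h: "periodic h" unfolding h_def by (intro avg_periodic g)
  have g': "periodic g'" using g(1) h by (simp add: periodic_def g'_def)
  have g'0: "0 \<le> g' x" "g' x \<le> g x" for x using g(2) by (auto simp: g'_def)
  have one: "periodic (\<lambda>_. 1::real)" by (simp add: periodic_def)
  have m0: "0 \<le> m" unfolding m_def by (intro ip_nonneg g'0) auto
  have "m = ip (avg p g') (\<lambda>_. 1)"
    unfolding m_def using avg_self_adjoint[OF p g' one] avg_const[OF p, of 1] by (simp add: ip_def)
  then have "m ^ 2 \<le> ip (avg p g') (avg p g') * ip (\<lambda>_. 1) (\<lambda>_. 1)"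
    using ip_cauchy_schwarz by simp
  also have "\<dots> = ip (avg p g') (avg p g')"
    using N_pos by (simp add: ip_def)
  also have "\<dots> = ip g' (avg p (avg p g'))"
    by (rule avg_self_adjoint[OF p g' avg_periodic[OF g'], symmetric])
  also have "\<dots> \<le> ip g' h"
    unfolding h_def by (intro ip_mono g'0 avg_mono p)
  also have "\<dots> \<le> \<kappa> * m"
    unfolding ip_def m_def times_divide_eq_right sum_distrib_left
  proof (intro divide_right_mono sum_mono)
    fix x
    show "g' x * h x \<le> \<kappa> * (g' x * 1)"
    proof (cases "h x < \<kappa>")
      case True
      then have "h x * g' x \<le> \<kappa> * g' x" using g'0 by (intro mult_right_mono) auto
      then show ?thesis by (simp add: mult.commute)
    qed (simp add: g'_def)
  qed simp
  finally have "m * m \<le> \<kappa> * m" by (simp add: power2_eq_square)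
  then have "m \<le> \<kappa>" using m0 \<kappa> by (cases "m = 0") auto
  then show ?thesis by (simp add: m_def g'_def ip_def h_def)
qed

lemma markov:
  assumes "\<And>x. 0 \<le> u x" "\<And>x. 0 \<le> v x"
  shows "\<theta> * ip u (\<lambda>x. of_bool (v x > \<theta>)) \<le> ip u v"
  unfolding ip_def times_divide_eq_right sum_distrib_left
proof (intro divide_right_mono sum_mono)
  fix x
  show "\<theta> * (u x * of_bool (v x > \<theta>)) \<le> u x * v x"
  proof (cases "v x > \<theta>")
    case True
    then have "\<theta> * u x \<le> v x * u x" using assms(1) by (intro mult_right_mono) auto
    then show ?thesis using True by (simp add: mult.commute)
  qed (use assms in auto)
qed simp

section \<open>Difference counts and the \<open>L^2\<close> norm of averaged sets\<close>

lemma kernel_sum_reflect: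
  assumes "kernel p" "periodic g"
  shows "(\<Sum>y\<in>R. p (y - x) * g (w - y)) = avg p g (w - x)"
proof -
  have "periodic (\<lambda>y. p (y - x) * g (w - y))"
    using assms by (intro periodic_mult_fun periodic_compose) (auto simp: kernel_def)
  from sum_shift[OF this, of x] show ?thesis
    by (simp add: avg_minus[OF assms] algebra_simps)
qed

lemma kernel_sum_1:
  assumes "kernel p"
  shows "(\<Sum>y\<in>R. p (y - x)) = 1"
  using sum_shift[of p "- x"] assms by (simp add: kernel_def)

lemma ip_avg_expand: "ip u (avg p v) = (\<Sum>s\<in>R. p s * ip u (\<lambda>x. v (x + s)))"
proof -
  have "(\<Sum>x\<in>R. u x * avg p v x) = (\<Sum>x\<in>R. \<Sum>s\<in>R. p s * (u x * v (x + s)))"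
    by (simp add: avg_def sum_distrib_left mult_ac)
  also have "\<dots> = (\<Sum>s\<in>R. p s * (\<Sum>x\<in>R. u x * v (x + s)))"
    by (subst sum.swap) (simp add: sum_distrib_left)
  finally show ?thesis by (simp only: ip_def sum_divide_distrib[of "\<lambda>s. p s * c s" for c] times_divide_eq_right)
qed

text \<open>\<open>r t\<close> counts representations of \<open>t\<close> as a difference in
  \<open>Y\<close> modulo \<open>N\<close>. For nonzero \<open>t\<close> its excess over one is at
  most the number of ordered pairs of distinct representations, and each pair gives a different
  nontrivial quadruple.\<close>

lemma sum_corr_le:
  assumes Y: "Y \<subseteq> R"
  defines "r \<equiv> \<lambda>t. real (card {y \<in> Y. (y + t) mod int N \<in> Y})"
  shows "\<exists>q. periodic q \<and> (\<forall>t. 0 \<le> q t) \<and> (\<forall>t. r t \<le> 1 + q t) \<and> (\<Sum>t\<in>R. q t) \<le> real (card Y) + real (nquads Y)"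
proof -
  have fin: "finite Y" using Y finite_subset by blast
  define S where "S t = {y \<in> Y. (y + t) mod int N \<in> Y}" for t
  define Pr where "Pr t = {(y, z). y \<in> S t \<and> z \<in> S t \<and> y \<noteq> z}" for t
  \<comment> \<open>At \<open>t = 0\<close> every element of \<open>Y\<close> is a representation,
    which is paid for by the term \<open>card Y\<close>.\<close>
  define q where "q t = real (if t mod int N = 0 then card Y else card (Pr t))" for t
  have finS: "finite (S t)" for t using fin by (simp add: S_def)
  have finPr: "finite (Pr t)" for t
    by (rule finite_subset[of _ "S t \<times> S t"]) (auto simp: Pr_def finS)
  have "card (S t) \<le> 1 + card (Pr t)" for t
  proof (cases "S t = {}")
    case False
    then obtain z where z: "z \<in> S t" by auto
    have "card (S t - {z}) \<le> card (Pr t)"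
      by (rule card_inj_on_le[where f = "\<lambda>y. (y, z)"]) (use z finPr in \<open>auto simp: Pr_def inj_on_def\<close>)
    then show ?thesis using z finS by (simp add: card_Diff_singleton)
  qed simp
  moreover have "card (S t) \<le> card Y" for t
    using fin by (intro card_mono) (auto simp: S_def)
  ultimately have "card (S t) \<le> 1 + (if t mod int N = 0 then card Y else card (Pr t))" for t
    by (simp add: le_SucI)
  then have "real (card (S t)) \<le> real (1 + (if t mod int N = 0 then card Y else card (Pr t)))" for t
    by (rule of_nat_mono)
  then have rq: "r t \<le> 1 + q t" for t
    by (simp add: r_def q_def S_def[symmetric])
  let ?Q = "{(y0, y1, y2, y3). y0 \<in> Y \<and> y1 \<in> Y \<and> y2 \<in> Y \<and> y3 \<in> Y \<and> int N dvd y0 + y1 - y2 - y3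
      \<and> \<not> (y0 = y2 \<and> y1 = y3) \<and> \<not> (y0 = y3 \<and> y1 = y2)}"
  have finQ: "finite ?Q"
    by (rule finite_subset[of _ "Y \<times> Y \<times> Y \<times> Y"]) (use fin in auto)
  \<comment> \<open>Two representations of \<open>t\<close> give
    \<open>(y + t) + z = y + (z + t)\<close>. It is nontrivial because \<open>t\<close> is nonzero
    and \<open>y\<close> differs from \<open>z\<close>; the first and third entries recover
    \<open>t\<close>.\<close>
  let ?F = "\<lambda>(t, y, z). ((y + t) mod int N, z, y, (z + t) mod int N)"
  have "(\<Sum>t\<in>R - {0}. card (Pr t)) = card (SIGMA t:R - {0}. Pr t)"
    using finPr by (simp add: card_SigmaI)
  also have "\<dots> \<le> card ?Q"
  proof (rule card_inj_on_le[where f = ?F])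
    have inj: "t = t'" if a: "(y + t) mod int N = (y + t') mod int N" "0 \<le> t" "t < int N" "0 \<le> t'" "t' < int N" for y t t'
    proof -
      have "(y + t - y) mod int N = (y + t' - y) mod int N" using a(1) by (metis mod_diff_left_eq)
      then show ?thesis using a by simp
    qed
    show "inj_on ?F (SIGMA t:R - {0}. Pr t)"
    proof (rule inj_onI)
      fix v w assume vw: "v \<in> (SIGMA t:R - {0}. Pr t)" "w \<in> (SIGMA t:R - {0}. Pr t)" and eq: "?F v = ?F w"
      obtain t y z where v: "v = (t, y, z)" by (cases v) auto
      obtain t' y' z' where w: "w = (t', y', z')" by (cases w) auto
      have yz: "y' = y" "z' = z" "(y + t) mod int N = (y + t') mod int N" using eq by (auto simp: v w)
      have "t = t'" using vw by (intro inj[OF yz(3)]) (auto simp: v w)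
      then show "v = w" by (simp add: v w yz)
    qed
    show "?F ` (SIGMA t:R - {0}. Pr t) \<subseteq> ?Q"
    proof (rule image_subsetI)
      fix w assume "w \<in> (SIGMA t:R - {0}. Pr t)"
      moreover obtain t y z where w: "w = (t, y, z)" by (cases w) auto
      ultimately have t: "t \<in> R" "t \<noteq> 0" and yz: "(y, z) \<in> Pr t" by auto
      have mem: "(y + t) mod int N \<in> Y" "z \<in> Y" "y \<in> Y" "(z + t) mod int N \<in> Y" "y \<noteq> z"
        using yz by (auto simp: Pr_def S_def)
      have "(y + t) mod int N + z - y - (z + t) mod int N =
          ((y + t) mod int N - (y + t)) - ((z + t) mod int N - (z + t))" by simp
      also have "int N dvd \<dots>" by (intro dvd_diff dvd_mod_diff)
      finally have dvd: "int N dvd (y + t) mod int N + z - y - (z + t) mod int N" .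
      have "(y + t) mod int N \<noteq> y"
      proof
        assume "(y + t) mod int N = y"
        then have "int N dvd (y + t) - y" by (metis dvd_minus_mod)
        then show False using t by (auto dest: zdvd_imp_le)
      qed
      then show "?F w \<in> ?Q" using mem dvd by (simp add: w)
    qed
  qed (rule finQ)
  finally have OQ: "(\<Sum>t\<in>R - {0}. card (Pr t)) \<le> nquads Y" by (simp add: nquads_def)
  have "(\<Sum>t\<in>R. q t) = q 0 + (\<Sum>t\<in>R - {0}. q t)"
    using N_pos by (subst sum.remove[of R 0]) auto
  also have "(\<Sum>t\<in>R - {0}. q t) = real (\<Sum>t\<in>R - {0}. card (Pr t))"
    unfolding of_nat_sum by (intro sum.cong refl) (auto simp: q_def)
  also have "\<dots> \<le> real (nquads Y)" using OQ of_nat_mono by blast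
  finally have "(\<Sum>t\<in>R. q t) \<le> real (card Y) + real (nquads Y)" by (simp add: q_def)
  moreover have "periodic q"
  proof -
    have "S (t + int N) = S t" for t
    proof -
      have "(y + (t + int N)) mod int N = (y + t) mod int N" for y
        by (metis add.assoc mod_add_self2)
      then show ?thesis by (simp add: S_def)
    qed
    then show ?thesis by (simp add: periodic_def q_def Pr_def)
  qed
  ultimately show ?thesis using rq by (intro exI[of _ q]) (auto simp: q_def)
qed

text \<open>The squared norm is the average of \<open>r (t + s)\<close> with both shifts drawn from
  \<open>p\<close>. Splitting \<open>r\<close> as \<open>1 + q\<close>, the constant contributes
  one, and \<open>q\<close> contributes at most its total mass times the largest value of
  \<open>p\<close>.\<close>

lemma energy_bound:
  assumes Y: "Y \<subseteq> R" and p: "kernel p" "\<And>s. p s \<le> M / real N"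
  shows "ip (avg p (ind Y)) (avg p (ind Y)) \<le> 1 + M / real N * (real (card Y) + real (nquads Y))"
proof -
  define r where "r = (\<lambda>t. real (card {y \<in> Y. (y + t) mod int N \<in> Y}))"
  have fin: "finite Y" using Y finite_subset by blast
  obtain q where q: "periodic q" "\<And>t. 0 \<le> q t" "\<And>t. r t \<le> 1 + q t"
    "(\<Sum>t\<in>R. q t) \<le> real (card Y) + real (nquads Y)"
    using sum_corr_le[OF Y] unfolding r_def by blast
  have M: "0 \<le> M / real N" using p kernel_def order_trans by blast
  have corr: "ip (ind Y) (\<lambda>x. ind Y (x + t)) = r t" for t
  proof -
    have "(\<Sum>x\<in>R. ind Y x * ind Y (x + t)) = sqrt (real N) * (\<Sum>y\<in>Y. ind Y (y + t))"
      using sum_ind[OF Y, of "\<lambda>x. ind Y (x + t)"] by simp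
    also have "(\<Sum>y\<in>Y. ind Y (y + t)) = sqrt (real N) * r t"
      using fin by (simp add: ind_def r_def sum_distrib_left[symmetric] of_bool_def sum.If_cases Int_def)
    finally have "(\<Sum>x\<in>R. ind Y x * ind Y (x + t)) = (sqrt (real N) * sqrt (real N)) * r t"
      by (simp only: mult.assoc)
    then show ?thesis using N_pos by (simp add: ip_def)
  qed
  have inner: "(\<Sum>s\<in>R. p s * r (t + s)) \<le> 1 + M / real N * (real (card Y) + real (nquads Y))" for t
  proof -
    have "(\<Sum>s\<in>R. p s * r (t + s)) \<le> (\<Sum>s\<in>R. p s + M / real N * q (s + t))"
    proof (rule sum_mono)
      fix s
      have p0: "0 \<le> p s" using p by (simp add: kernel_def)
      have "p s * r (t + s) \<le> p s * (1 + q (t + s))" using q(3) p0 by (rule mult_left_mono)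
      also have "\<dots> = p s + p s * q (s + t)" by (simp add: distrib_left add.commute)
      also have "\<dots> \<le> p s + M / real N * q (s + t)"
        using p(2) q(2) by (intro add_left_mono mult_right_mono) auto
      finally show "p s * r (t + s) \<le> p s + M / real N * q (s + t)" .
    qed
    also have "\<dots> = 1 + M / real N * (\<Sum>s\<in>R. q s)"
      unfolding sum.distrib sum_distrib_left[symmetric] sum_shift[OF q(1)] using p(1) by (simp add: kernel_def)
    also have "\<dots> \<le> 1 + M / real N * (real (card Y) + real (nquads Y))"
      using q(4) M by (intro add_left_mono mult_left_mono) auto
    finally show ?thesis .
  qed
  have "ip (avg p (ind Y)) (avg p (ind Y)) = ip (ind Y) (avg p (avg p (ind Y)))"
    by (rule avg_self_adjoint[OF p(1) periodic_ind avg_periodic[OF periodic_ind], symmetric])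
  also have "\<dots> = (\<Sum>t\<in>R. p t * (\<Sum>s\<in>R. p s * r (t + s)))"
  proof -
    have "ip (ind Y) (\<lambda>x. avg p (ind Y) (x + t)) = (\<Sum>s\<in>R. p s * r (t + s))" for t
    proof -
      have "(\<lambda>x. avg p (ind Y) (x + t)) = avg p (\<lambda>x. ind Y (x + t))"
        by (simp add: fun_eq_iff avg_def add_ac)
      then show ?thesis by (simp add: ip_avg_expand corr[symmetric] add_ac)
    qed
    then show ?thesis by (simp add: ip_avg_expand)
  qed
  also have "\<dots> \<le> (\<Sum>t\<in>R. p t * (1 + M / real N * (real (card Y) + real (nquads Y))))"
    using p(1) inner by (intro sum_mono mult_left_mono) (auto simp: kernel_def)
  also have "\<dots> = 1 + M / real N * (real (card Y) + real (nquads Y))"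
    using p(1) unfolding sum_distrib_right[symmetric] by (simp add: kernel_def)
  finally show ?thesis .
qed

section \<open>Iterated averages\<close>

lemma funpow_avg_periodic: "periodic g \<Longrightarrow> periodic ((avg p ^^ n) g)"
  by (induction n) (auto intro: avg_periodic)

lemma funpow_avg_nonneg: "kernel p \<Longrightarrow> (\<And>x. 0 \<le> g x) \<Longrightarrow> 0 \<le> (avg p ^^ n) g x"
  by (induction n arbitrary: x) (auto intro!: avg_nonneg)

lemma funpow_avg_self_adjoint:
  assumes "kernel p" "periodic u" "periodic v"
  shows "ip u ((avg p ^^ n) v) = ip ((avg p ^^ n) u) v"
  using assms(2)
proof (induction n arbitrary: u)
  case (Suc n)
  have "ip u ((avg p ^^ Suc n) v) = ip (avg p u) ((avg p ^^ n) v)"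
    using avg_self_adjoint[OF assms(1) Suc.prems funpow_avg_periodic[OF assms(3)]] by simp
  also have "\<dots> = ip ((avg p ^^ n) (avg p u)) v"
    by (rule Suc.IH[OF avg_periodic[OF Suc.prems]])
  finally show ?case by (simp add: funpow_swap1)
qed simp

lemma funpow_avg_contraction:
  assumes "kernel p" "periodic u" "0 < n"
  shows "ip ((avg p ^^ n) u) ((avg p ^^ n) u) \<le> ip (avg p u) (avg p u)"
  using assms(3)
proof (induction n rule: nat_induct_non_zero)
  case (Suc n)
  have "ip ((avg p ^^ Suc n) u) ((avg p ^^ Suc n) u) \<le> ip ((avg p ^^ n) u) ((avg p ^^ n) u)"
    using avg_contraction[OF assms(1) funpow_avg_periodic[OF assms(2)]] by simp
  then show ?case using Suc.IH by linarith
qed simp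

text \<open>After Markov the averages move onto \<open>u\<close>, and Cauchy-Schwarz separates
  \<open>u\<close> from \<open>d\<close>. Since \<open>n\<close> is positive, at least one average
  stays on \<open>u\<close>; this matters for indicators, whose unaveraged \<open>L^2\<close> norm
  is unbounded.\<close>

lemma averaged_mass:
  assumes p: "kernel p" and u: "periodic u" "\<And>x. 0 \<le> u x" and d: "periodic d" "\<And>x. 0 \<le> d x"
    and n: "0 < n" and \<theta>: "0 < \<theta>"
    and u2: "ip (avg p u) (avg p u) \<le> C" and d2: "ip d d \<le> \<sigma>"
  shows "ip u (\<lambda>x. of_bool ((avg p ^^ n) d x > \<theta>)) \<le> sqrt (C * \<sigma>) / \<theta>"
proof -
  let ?u = "(avg p ^^ n) u"
  have nn: "0 \<le> ip d d" "0 \<le> ip ?u ?u" by (auto simp: ip_def intro!: divide_nonneg_nonneg sum_nonneg)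
  have "\<theta> * ip u (\<lambda>x. of_bool ((avg p ^^ n) d x > \<theta>)) \<le> ip u ((avg p ^^ n) d)"
    by (rule markov[OF u(2) funpow_avg_nonneg[OF p d(2)]])
  also have "\<dots> = ip ?u d" by (rule funpow_avg_self_adjoint[OF p u(1) d(1)])
  also have "\<dots> \<le> sqrt (C * \<sigma>)"
  proof (rule real_le_rsqrt)
    have "(ip ?u d) ^ 2 \<le> ip ?u ?u * ip d d" by (rule ip_cauchy_schwarz)
    also have "\<dots> \<le> C * \<sigma>"
      using funpow_avg_contraction[OF p u(1) n] u2 d2 nn by (intro mult_mono) auto
    finally show "(ip ?u d) ^ 2 \<le> C * \<sigma>" .
  qed
  finally show ?thesis using \<theta> by (simp add: field_simps)
qed

end

context scales
begin

section \<open>Comparing two scales\<close>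

text \<open>By self-adjointness this single-average energy equals
  \<open>ip (f i) (smooth \<eta> i)\<close>, the form in which scales are compared.\<close>

definition E :: "real \<Rightarrow> nat \<Rightarrow> real" where
  "E \<eta> i = ip (A \<eta> (f i)) (A \<eta> (f i))"

definition D :: "real \<Rightarrow> real \<Rightarrow> nat \<Rightarrow> int \<Rightarrow> real" where
  "D \<eta> \<eta>' i x = \<bar>smooth \<eta>' i x - smooth \<eta> i x\<bar>"

lemma D_periodic: "i < 5 \<Longrightarrow> periodic (D \<eta> \<eta>' i)"
  using smooth_periodic[of i \<eta>] smooth_periodic[of i \<eta>'] by (simp add: periodic_def D_def)

lemma D_nonneg: "0 \<le> D \<eta> \<eta>' i x"
  by (simp add: D_def)

lemma smooth_lipschitz:
  assumes "0 < \<eta>'" "\<eta>' \<le> \<eta>" "bohr_norm \<eta>' s \<le> \<eta>'" "i < 5"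
  shows "\<bar>smooth \<eta> i (x + s) - smooth \<eta> i x\<bar> \<le> 2 * dens \<eta> * \<eta>' / \<eta>"
proof -
  have \<eta>: "0 < \<eta>" using assms by simp
  show ?thesis
    unfolding smooth_def
    using assms \<eta> f_sum sum_avg[OF kernel_ker[OF \<eta>] f_periodic]
    by (intro A_lipschitz avg_periodic f_periodic avg_nonneg kernel_ker f_nonneg) auto
qed

text \<open>Expand the square of the difference. Both square terms are at most the energies by
  contraction, and the cross term nearly equals \<open>E \<eta> i\<close>, because the fine averages
  can be moved onto the coarse smoothing, which they hardly change.\<close>

lemma energy_increment:
  assumes "0 < \<eta>'" "\<eta>' \<le> \<eta>" "i < 5"
  shows "ip (D \<eta> \<eta>' i) (D \<eta> \<eta>' i) \<le> E \<eta>' i - E \<eta> i + 16 * dens \<eta> * \<eta>' / \<eta>"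
proof -
  have \<eta>: "0 < \<eta>" using assms by simp
  let ?h = "smooth \<eta> i" and ?h' = "smooth \<eta>' i" and ?f = "f i"
  let ?c = "2 * dens \<eta> * \<eta>' / \<eta>"
  note k = kernel_ker[OF \<eta>] and k' = kernel_ker[OF assms(1)] and per = f_periodic[OF assms(3)]
  have close: "\<bar>A \<eta>' ?h x - ?h x\<bar> \<le> ?c" for x
    using assms by (intro A_close smooth_lipschitz) auto
  have "\<bar>A \<eta>' (A \<eta>' ?h) x - A \<eta>' ?h x\<bar> \<le> ?c" for x
    by (rule avg_diff_le[OF k' close])
  then have close2: "?h x - 2 * ?c \<le> A \<eta>' (A \<eta>' ?h) x" for x
    using close[of x] by (smt (verit))
  have c0: "0 \<le> ?c" using dens_ge_1[of \<eta>] assms(1) \<eta> by simp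
  \<comment> \<open>The pointwise loss \<open>2 * ?c\<close> is integrated against
    \<open>f i\<close>, of mean at most 2.\<close>
  have "ip ?f ?h - 4 * ?c \<le> ip ?f (\<lambda>x. ?h x - 2 * ?c)"
  proof -
    have "ip ?f (\<lambda>x. ?h x - 2 * ?c) = ip ?f ?h - (2 * ?c) * (\<Sum>x\<in>R. ?f x) / real N"
      unfolding ip_def right_diff_distrib sum_subtractf diff_divide_distrib sum_distrib_left
      by (simp add: mult.commute)
    moreover have "(2 * ?c) * (\<Sum>x\<in>R. ?f x) / real N \<le> (2 * ?c) * (2 * real N) / real N"
      using f_sum[OF assms(3)] c0 by (intro divide_right_mono mult_left_mono) auto
    ultimately show ?thesis using N_pos by simp
  qed
  also have "\<dots> \<le> ip ?f (A \<eta>' (A \<eta>' ?h))"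
    by (intro ip_mono f_nonneg assms close2)
  also have "\<dots> = ip (A \<eta>' ?f) (A \<eta>' ?h)"
    by (rule avg_self_adjoint[OF k' per avg_periodic[OF smooth_periodic[OF assms(3)]]])
  also have "\<dots> = ip ?h' ?h"
    unfolding smooth_def[of \<eta>'] by (rule avg_self_adjoint[OF k' avg_periodic[OF per] smooth_periodic[OF assms(3)]])
  finally have cross: "ip ?f ?h - 4 * ?c \<le> ip ?h' ?h" .
  have fh: "ip ?f ?h = E \<eta> i"
    unfolding smooth_def E_def by (rule avg_self_adjoint[OF k per avg_periodic[OF per]])
  have "ip (D \<eta> \<eta>' i) (D \<eta> \<eta>' i) = ip ?h' ?h' + ip ?h ?h - 2 * ip ?h' ?h"
  proof -
    have "D \<eta> \<eta>' i x * D \<eta> \<eta>' i x = ?h' x * ?h' x + ?h x * ?h x - 2 * (?h' x * ?h x)" for x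
      by (simp add: D_def abs_mult_self_eq algebra_simps)
    then show ?thesis
      by (simp add: ip_def sum.distrib sum_subtractf sum_distrib_left[symmetric] add_divide_distrib diff_divide_distrib)
  qed
  moreover have "ip ?h' ?h' \<le> E \<eta>' i" "ip ?h ?h \<le> E \<eta> i"
    unfolding smooth_def E_def by (auto intro!: avg_contraction k k' avg_periodic per)
  ultimately show ?thesis using cross fh by simp
qed

text \<open>Perturb the solution by \<open>y i = x i + s i\<close> with \<open>s 0, \<dots>, s 3\<close> drawn independently from the
  kernel at scale \<open>\<zeta>\<close>; then \<open>y 4\<close> is distributed as a fourfold average, hence the power 4.\<close>

lemma dense_count:
  assumes scal: "0 < \<eta>'" "\<eta>' \<le> \<zeta>" "\<zeta> \<le> \<eta>" and \<kappa>: "0 < \<kappa>" "16 * dens \<eta> * \<zeta> / \<eta> \<le> \<kappa>"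
    and sol: "int N dvd x 0 + x 1 + x 2 + x 3 + x 4"
    and high: "\<And>i. i < 5 \<Longrightarrow> \<kappa> \<le> smooth \<eta> i (x i)"
    and small: "\<And>i. i < 4 \<Longrightarrow> A \<zeta> (D \<eta> \<eta>' i) (x i) \<le> \<kappa> / 40"
    and small4: "(A \<zeta> ^^ 4) (D \<eta> \<eta>' 4) (x 4) \<le> \<kappa> / 40"
  shows "(\<kappa> / 4) ^ 5 / (2 * dens \<zeta> ^ 4) \<le> T (smooth \<eta>')"
proof -
  have pos: "0 < \<zeta>" "0 < \<eta>" using scal by auto
  define M where "M = dens \<zeta>"
  have M: "1 \<le> M" by (simp add: M_def dens_ge_1)
  let ?k = "ker \<zeta>" and ?h = "smooth \<eta>'" and ?d = "D \<eta> \<eta>'"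
  let ?ka = "\<lambda>y. ?k (y - x 0)" and ?kb = "\<lambda>y. ?k (y - x 1)" and ?kc = "\<lambda>y. ?k (y - x 2)" and ?kd = "\<lambda>y. ?k (y - x 3)"
  \<comment> \<open>The change of a coarse smoothing under one shift at scale
    \<open>\<zeta>\<close>; the hypothesis on \<open>\<kappa>\<close> says that four shifts lose at
    most \<open>\<kappa> / 2\<close>.\<close>
  define c where "c = 2 * dens \<eta> * \<zeta> / \<eta>"
  have c: "8 * c \<le> \<kappa>" using \<kappa>(2) by (simp add: c_def)
  note ker = kernel_ker[OF pos(1)]
  have k0: "0 \<le> ?k s" "?k s * (real N / M) \<le> 1" for s
  proof -
    show "0 \<le> ?k s" using ker by (simp add: kernel_def)
    have "?k s * (real N / M) \<le> M / real N * (real N / M)"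
      unfolding M_def using ker_le[OF pos(1)] dens_ge_1[of \<zeta>] by (intro mult_right_mono) auto
    then show "?k s * (real N / M) \<le> 1" using M N_pos by simp
  qed
  have lip: "\<bar>smooth \<eta> i (z + s) - smooth \<eta> i z\<bar> \<le> c" if "i < 5" "bohr_norm \<zeta> s \<le> \<zeta>" for i z s
    unfolding c_def using smooth_lipschitz[OF pos(1) scal(3)] that by simp
  have c0: "0 \<le> c" using dens_ge_1[of \<eta>] pos by (simp add: c_def)
  define P where "P y0 y1 y2 y3 = ?k (y0 - x 0) * ?k (y1 - x 1) * ?k (y2 - x 2) * ?k (y3 - x 3)" for y0 y1 y2 y3
  define d where "d y0 y1 y2 y3 = ?d 0 y0 + ?d 1 y1 + ?d 2 y2 + ?d 3 y3 + ?d 4 (- (y0 + y1 + y2 + y3))" for y0 y1 y2 y3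
  \<comment> \<open>A pointwise bound by the perturbation density \<open>P\<close>, to be summed
    over all \<open>y0, ..., y3\<close>.\<close>
  have pw: "(real N / M) ^ 4 * (\<kappa> / 4) ^ 5 * (P y0 y1 y2 y3 * (1 - 4 / \<kappa> * d y0 y1 y2 y3)) \<le>
      ?h 0 y0 * ?h 1 y1 * ?h 2 y2 * ?h 3 y3 * ?h 4 (- (y0 + y1 + y2 + y3))" (is "?lhs \<le> ?rhs") for y0 y1 y2 y3
  proof (cases "P y0 y1 y2 y3 = 0")
    case True
    then show ?thesis using smooth_nonneg[OF scal(1)] by simp
  next
    case False
    define s0 s1 s2 s3 where s: "s0 = y0 - x 0" "s1 = y1 - x 1" "s2 = y2 - x 2" "s3 = y3 - x 3"
    have nz: "?k s0 \<noteq> 0" "?k s1 \<noteq> 0" "?k s2 \<noteq> 0" "?k s3 \<noteq> 0" using False by (auto simp: P_def s)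
    note sup = ker_support[OF pos(1)]
    have n: "bohr_norm \<zeta> s0 \<le> \<zeta>" "bohr_norm \<zeta> s1 \<le> \<zeta>" "bohr_norm \<zeta> s2 \<le> \<zeta>" "bohr_norm \<zeta> s3 \<le> \<zeta>"
      using nz sup by auto
    have nm: "bohr_norm \<zeta> (- s0) \<le> \<zeta>" "bohr_norm \<zeta> (- s1) \<le> \<zeta>" "bohr_norm \<zeta> (- s2) \<le> \<zeta>" "bohr_norm \<zeta> (- s3) \<le> \<zeta>"
      using n by (auto simp: bohr_norm_minus)
    have low1: "\<kappa> / 2 - ?d i (x i + t) \<le> ?h i (x i + t)" if "i < 5" "bohr_norm \<zeta> t \<le> \<zeta>" for i t
      using lip[OF that, of "x i"] high[OF that(1)] c c0 \<kappa>(1) unfolding D_def by linarith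
    have y: "y0 = x 0 + s0" "y1 = x 1 + s1" "y2 = x 2 + s2" "y3 = x 3 + s3" by (auto simp: s)
    \<comment> \<open>As \<open>x\<close> is a solution, the completing point is congruent to
      \<open>x 4\<close> moved by four shifts, which is why four Lipschitz steps are spent on
      it.\<close>
    define w where "w = x 4 + - s0 + - s1 + - s2 + - s3"
    have per4: "g (- (y0 + y1 + y2 + y3)) = g w" if "periodic g" for g :: "int \<Rightarrow> real"
      using sol unfolding w_def by (intro periodic_cong[OF that]) (simp add: s algebra_simps dvd_minus_iff[symmetric, of _ "x 0 + _"])
    have low4: "\<kappa> / 2 - ?d 4 w \<le> ?h 4 w"
    proof -
      have "\<bar>smooth \<eta> 4 w - smooth \<eta> 4 (x 4)\<bar> \<le> 4 * c"
        unfolding w_def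
        using lip[OF _ nm(1), of 4 "x 4"] lip[OF _ nm(2), of 4 "x 4 + - s0"] lip[OF _ nm(3), of 4 "x 4 + - s0 + - s1"]
          lip[OF _ nm(4), of 4 "x 4 + - s0 + - s1 + - s2"] by linarith
      then show ?thesis using high[of 4] c c0 \<kappa>(1) unfolding D_def by linarith
    qed
    have l: "\<kappa> / 2 - ?d 0 y0 \<le> ?h 0 y0" "\<kappa> / 2 - ?d 1 y1 \<le> ?h 1 y1"
      "\<kappa> / 2 - ?d 2 y2 \<le> ?h 2 y2" "\<kappa> / 2 - ?d 3 y3 \<le> ?h 3 y3"
      unfolding y using low1 n by auto
    have main: "(\<kappa> / 4) ^ 5 * (1 - 4 / \<kappa> * d y0 y1 y2 y3) \<le> ?rhs"
      unfolding d_def per4[OF smooth_periodic[of 4 \<eta>', simplified]] per4[OF D_periodic[of 4 \<eta> \<eta>', simplified]]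
      by (rule prod5_ge[OF \<kappa>(1) _ _ _ _ _ _ _ _ _ _ l low4]) (auto intro: smooth_nonneg[OF scal(1)] D_nonneg)
    \<comment> \<open>\<open>ker_le\<close> gives \<open>q \<le> 1\<close>, so multiplying the
      nonnegative product by \<open>q\<close> only lowers it.\<close>
    define q where "q = (real N / M) ^ 4 * P y0 y1 y2 y3"
    have q: "q = (?k s0 * (real N / M)) * (?k s1 * (real N / M)) * (?k s2 * (real N / M)) * (?k s3 * (real N / M))"
      by (simp add: q_def P_def s power4_eq_xxxx mult_ac)
    have q01: "0 \<le> q" "q \<le> 1"
    proof -
      show "0 \<le> q" unfolding q using k0(1) M by (intro mult_nonneg_nonneg) auto
      have "q \<le> 1 * 1 * 1 * 1" unfolding q using k0 M by (intro mult_mono mult_nonneg_nonneg) auto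
      then show "q \<le> 1" by simp
    qed
    have "?lhs = q * ((\<kappa> / 4) ^ 5 * (1 - 4 / \<kappa> * d y0 y1 y2 y3))" by (simp add: q_def mult_ac)
    also have "\<dots> \<le> q * ?rhs" using main q01 by (intro mult_left_mono) auto
    also have "\<dots> \<le> ?rhs" using q01 smooth_nonneg[OF scal(1)] by (intro mult_left_le_one_le) auto
    finally show ?thesis .
  qed
  have sumP: "(\<Sum>y0\<in>R. \<Sum>y1\<in>R. \<Sum>y2\<in>R. \<Sum>y3\<in>R. P y0 y1 y2 y3) = 1"
    using sum_factor4[where ?g0.0 = ?ka and ?g1.0 = ?kb and ?g2.0 = ?kc and ?g3.0 = ?kd and z = 1 and A = R and B = R and C = R and D = R]
    by (simp add: P_def kernel_sum_1[OF ker])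
  have sum0: "(\<Sum>y0\<in>R. \<Sum>y1\<in>R. \<Sum>y2\<in>R. \<Sum>y3\<in>R. P y0 y1 y2 y3 * ?d 0 y0) = A \<zeta> (?d 0) (x 0)"
    using sum_factor4[where ?g0.0 = "\<lambda>y. ?ka y * ?d 0 y" and ?g1.0 = ?kb and ?g2.0 = ?kc and ?g3.0 = ?kd and z = 1 and A = R and B = R and C = R and D = R]
    by (simp add: P_def kernel_sum_1[OF ker] avg_alt[OF ker D_periodic] mult_ac)
  have sum1: "(\<Sum>y0\<in>R. \<Sum>y1\<in>R. \<Sum>y2\<in>R. \<Sum>y3\<in>R. P y0 y1 y2 y3 * ?d 1 y1) = A \<zeta> (?d 1) (x 1)"
    using sum_factor4[where ?g1.0 = "\<lambda>y. ?kb y * ?d 1 y" and ?g0.0 = ?ka and ?g2.0 = ?kc and ?g3.0 = ?kd and z = 1 and A = R and B = R and C = R and D = R]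
    by (simp add: P_def kernel_sum_1[OF ker] avg_alt[OF ker D_periodic] mult_ac)
  have sum2: "(\<Sum>y0\<in>R. \<Sum>y1\<in>R. \<Sum>y2\<in>R. \<Sum>y3\<in>R. P y0 y1 y2 y3 * ?d 2 y2) = A \<zeta> (?d 2) (x 2)"
    using sum_factor4[where ?g2.0 = "\<lambda>y. ?kc y * ?d 2 y" and ?g0.0 = ?ka and ?g1.0 = ?kb and ?g3.0 = ?kd and z = 1 and A = R and B = R and C = R and D = R]
    by (simp add: P_def kernel_sum_1[OF ker] avg_alt[OF ker D_periodic] mult_ac)
  have sum3: "(\<Sum>y0\<in>R. \<Sum>y1\<in>R. \<Sum>y2\<in>R. \<Sum>y3\<in>R. P y0 y1 y2 y3 * ?d 3 y3) = A \<zeta> (?d 3) (x 3)"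
    using sum_factor4[where ?g3.0 = "\<lambda>y. ?kd y * ?d 3 y" and ?g0.0 = ?ka and ?g1.0 = ?kb and ?g2.0 = ?kc and z = 1 and A = R and B = R and C = R and D = R]
    by (simp add: P_def kernel_sum_1[OF ker] avg_alt[OF ker D_periodic] mult_ac)
  \<comment> \<open>Summing out \<open>y3\<close>, \<open>y2\<close>, \<open>y1\<close>,
    \<open>y0\<close> in turn adds one average each time; the final argument is congruent to
    \<open>x 4\<close>.\<close>
  have sum4: "(\<Sum>y0\<in>R. \<Sum>y1\<in>R. \<Sum>y2\<in>R. \<Sum>y3\<in>R. P y0 y1 y2 y3 * ?d 4 (- (y0 + y1 + y2 + y3))) = (A \<zeta> ^^ 4) (?d 4) (x 4)"
  proof -
    have d4: "periodic (?d 4)" by (rule D_periodic) simp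
    note refl3 = kernel_sum_reflect[OF ker]
    have "(\<Sum>y0\<in>R. \<Sum>y1\<in>R. \<Sum>y2\<in>R. \<Sum>y3\<in>R. P y0 y1 y2 y3 * ?d 4 (- (y0 + y1 + y2 + y3))) =
      (\<Sum>y0\<in>R. ?ka y0 * (\<Sum>y1\<in>R. ?kb y1 * (\<Sum>y2\<in>R. ?kc y2 * (\<Sum>y3\<in>R. ?kd y3 * ?d 4 (- y0 - y1 - y2 - y3)))))"
      by (simp add: P_def sum_distrib_left mult.assoc)
    also have "\<dots> = (\<Sum>y0\<in>R. ?ka y0 * (\<Sum>y1\<in>R. ?kb y1 * (\<Sum>y2\<in>R. ?kc y2 * A \<zeta> (?d 4) ((- y0 - y1 - x 3) - y2))))"
      unfolding refl3[OF d4] by (simp add: algebra_simps)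
    also have "\<dots> = (\<Sum>y0\<in>R. ?ka y0 * (\<Sum>y1\<in>R. ?kb y1 * A \<zeta> (A \<zeta> (?d 4)) ((- y0 - x 3 - x 2) - y1)))"
      unfolding refl3[OF avg_periodic[OF d4]] by (simp add: algebra_simps)
    also have "\<dots> = (\<Sum>y0\<in>R. ?ka y0 * A \<zeta> (A \<zeta> (A \<zeta> (?d 4))) ((- x 3 - x 2 - x 1) - y0))"
      unfolding refl3[OF avg_periodic[OF avg_periodic[OF d4]]]
      by (intro sum.cong refl arg_cong2[where f = "(*)"] arg_cong[where f = "A \<zeta> (A \<zeta> (A \<zeta> (?d 4)))"]) simp
    also have "\<dots> = A \<zeta> (A \<zeta> (A \<zeta> (A \<zeta> (?d 4)))) (- x 3 - x 2 - x 1 - x 0)"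
      unfolding refl3[OF avg_periodic[OF avg_periodic[OF avg_periodic[OF d4]]]] ..
    also have "\<dots> = A \<zeta> (A \<zeta> (A \<zeta> (A \<zeta> (?d 4)))) (x 4)"
    proof (rule periodic_cong)
      have "- x 3 - x 2 - x 1 - x 0 - x 4 = - (x 0 + x 1 + x 2 + x 3 + x 4)" by simp
      then show "int N dvd - x 3 - x 2 - x 1 - x 0 - x 4" using sol by (simp only: dvd_minus_iff)
    qed (intro avg_periodic d4)
    finally show ?thesis by (simp add: eval_nat_numeral)
  qed
  \<comment> \<open>Five errors of at most \<open>\<kappa> / 40\<close> each; hence the averaged
    factor \<open>1 - 4 / \<kappa> * d\<close> is still at least \<open>1/2\<close>.\<close>
  have sumd: "(\<Sum>y0\<in>R. \<Sum>y1\<in>R. \<Sum>y2\<in>R. \<Sum>y3\<in>R. P y0 y1 y2 y3 * d y0 y1 y2 y3) \<le> \<kappa> / 8"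
    unfolding d_def distrib_left sum.distrib sum0 sum1 sum2 sum3 sum4
    using small[of 0] small[of 1] small[of 2] small[of 3] small4 by simp
  have "(real N / M) ^ 4 * (\<kappa> / 4) ^ 5 * (1 / 2) \<le>
      (real N / M) ^ 4 * (\<kappa> / 4) ^ 5 * (1 - 4 / \<kappa> * (\<Sum>y0\<in>R. \<Sum>y1\<in>R. \<Sum>y2\<in>R. \<Sum>y3\<in>R. P y0 y1 y2 y3 * d y0 y1 y2 y3))"
    using sumd \<kappa>(1) M by (intro mult_left_mono) (auto simp: field_simps)
  also have "\<dots> = (\<Sum>y0\<in>R. \<Sum>y1\<in>R. \<Sum>y2\<in>R. \<Sum>y3\<in>R.
      (real N / M) ^ 4 * (\<kappa> / 4) ^ 5 * (P y0 y1 y2 y3 * (1 - 4 / \<kappa> * d y0 y1 y2 y3)))"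
  proof -
    let ?c = "(real N / M) ^ 4 * (\<kappa> / 4) ^ 5"
    have "(\<Sum>y0\<in>R. \<Sum>y1\<in>R. \<Sum>y2\<in>R. \<Sum>y3\<in>R. ?c * (P y0 y1 y2 y3 * (1 - 4 / \<kappa> * d y0 y1 y2 y3))) =
      (\<Sum>y0\<in>R. \<Sum>y1\<in>R. \<Sum>y2\<in>R. \<Sum>y3\<in>R. ?c * P y0 y1 y2 y3 - ?c * (4 / \<kappa>) * (P y0 y1 y2 y3 * d y0 y1 y2 y3))"
      by (intro sum.cong refl) (simp add: right_diff_distrib mult_ac)
    then show ?thesis
      by (simp only: sum_subtractf sum_distrib_left[symmetric] sumP) (simp add: right_diff_distrib)
  qed
  also have "\<dots> \<le> real N ^ 4 * T ?h"
  proof -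
    have "real N ^ 4 * T ?h = (\<Sum>y0\<in>R. \<Sum>y1\<in>R. \<Sum>y2\<in>R. \<Sum>y3\<in>R.
        ?h 0 y0 * ?h 1 y1 * ?h 2 y2 * ?h 3 y3 * ?h 4 (- (y0 + y1 + y2 + y3)))"
      using N_pos by (simp add: T_def)
    then show ?thesis by (simp only:) (intro sum_mono pw)
  qed
  finally have "(real N ^ 4 * ((\<kappa> / 4) ^ 5 / (2 * M ^ 4))) \<le> real N ^ 4 * T ?h"
    by (simp add: power_divide)
  then show ?thesis
    unfolding M_def[symmetric] using N_pos by (simp only: mult_le_cancel_left_pos zero_less_power of_nat_0_less_iff)
qed

text \<open>The two terms of the mass bound come from \<open>low_mass\<close> and
  \<open>averaged_mass\<close>. A solution avoiding the bad points would force, by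
  \<open>dense_count\<close>, a larger count at scale \<open>\<eta>'\<close> than
  \<open>T_smooth\<close> permits.\<close>

lemma removal_step:
  assumes scal: "0 < \<eta>'" "\<eta>' \<le> \<zeta>" "\<zeta> \<le> \<eta>" and \<kappa>: "0 < \<kappa>" "16 * dens \<eta> * \<zeta> / \<eta> \<le> \<kappa>"
    and E2: "\<And>i. i < 5 \<Longrightarrow> E \<zeta> i \<le> 2"
    and inc: "\<And>i. i < 5 \<Longrightarrow> ip (D \<eta> \<eta>' i) (D \<eta> \<eta>' i) \<le> \<sigma>"
    and count: "T f + 140 * \<eta>' < (\<kappa> / 4) ^ 5 / (2 * dens \<zeta> ^ 4)"
  shows "\<exists>bad. (\<forall>i<5. ip (f i) (\<lambda>x. of_bool (bad i x)) \<le> \<kappa> + sqrt (2 * \<sigma>) / (\<kappa> / 40)) \<and>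
      (\<forall>x. (\<forall>i<5. \<not> bad i (x i)) \<longrightarrow> \<not> int N dvd x 0 + x 1 + x 2 + x 3 + x 4)"
proof -
  have pos: "0 < \<zeta>" "0 < \<eta>" using scal by auto
  \<comment> \<open>The last coordinate absorbs the four independent shifts of the others.\<close>
  define n where "n i = (if i < 4 then 1 else 4 :: nat)" for i :: nat
  define bad where "bad i x \<longleftrightarrow> smooth \<eta> i x < \<kappa> \<or> (A \<zeta> ^^ n i) (D \<eta> \<eta>' i) x > \<kappa> / 40" for i x
  have "ip (f i) (\<lambda>x. of_bool (bad i x)) \<le> \<kappa> + sqrt (2 * \<sigma>) / (\<kappa> / 40)" if i: "i < 5" for i
  proof -
    have "ip (f i) (\<lambda>x. of_bool (bad i x)) \<le>
        ip (f i) (\<lambda>x. of_bool (smooth \<eta> i x < \<kappa>) + of_bool ((A \<zeta> ^^ n i) (D \<eta> \<eta>' i) x > \<kappa> / 40))"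
      by (intro ip_mono f_nonneg i) (auto simp: bad_def)
    also have "\<dots> = ip (f i) (\<lambda>x. of_bool (smooth \<eta> i x < \<kappa>)) +
        ip (f i) (\<lambda>x. of_bool ((A \<zeta> ^^ n i) (D \<eta> \<eta>' i) x > \<kappa> / 40))"
      by (simp only: ip_def distrib_left sum.distrib add_divide_distrib)
    also have "\<dots> \<le> \<kappa> + sqrt (2 * \<sigma>) / (\<kappa> / 40)"
    proof (rule add_mono)
      show "ip (f i) (\<lambda>x. of_bool (smooth \<eta> i x < \<kappa>)) \<le> \<kappa>"
        unfolding smooth_def by (intro low_mass kernel_ker f_periodic f_nonneg i pos \<kappa>)
      show "ip (f i) (\<lambda>x. of_bool ((A \<zeta> ^^ n i) (D \<eta> \<eta>' i) x > \<kappa> / 40)) \<le> sqrt (2 * \<sigma>) / (\<kappa> / 40)"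
        using E2[OF i] inc[OF i] \<kappa>(1)
        by (intro averaged_mass kernel_ker f_periodic f_nonneg D_periodic D_nonneg i pos) (auto simp: n_def E_def)
    qed
    finally show ?thesis .
  qed
  moreover have "\<not> int N dvd x 0 + x 1 + x 2 + x 3 + x 4" if good: "\<forall>i<5. \<not> bad i (x i)" for x
  proof
    assume sol: "int N dvd x 0 + x 1 + x 2 + x 3 + x 4"
    have high: "\<kappa> \<le> smooth \<eta> i (x i)" if "i < 5" for i using good that by (auto simp: bad_def not_less)
    have small: "(A \<zeta> ^^ n i) (D \<eta> \<eta>' i) (x i) \<le> \<kappa> / 40" if "i < 5" for i
      using good that by (auto simp: bad_def not_less)
    have small1: "A \<zeta> (D \<eta> \<eta>' i) (x i) \<le> \<kappa> / 40" if "i < 4" for i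
      using small[of i] that by (simp add: n_def)
    have small4: "(A \<zeta> ^^ 4) (D \<eta> \<eta>' 4) (x 4) \<le> \<kappa> / 40"
      using small[of 4] by (simp add: n_def)
    have "(\<kappa> / 4) ^ 5 / (2 * dens \<zeta> ^ 4) \<le> T (smooth \<eta>')"
      by (rule dense_count[OF scal \<kappa> sol high small1 small4])
    then show False using T_smooth[OF scal(1)] count by linarith
  qed
  ultimately show ?thesis by (intro exI[of _ bad]) auto
qed

end

context cyclic
begin

section \<open>From inner products and \<open>T\<close> to cardinalities\<close>

lemma ip_ind:
  assumes "Y \<subseteq> R"
  shows "ip (ind Y) (\<lambda>x. of_bool (P x)) = real (card {y \<in> Y. P y}) / sqrt (real N)"
proof -
  have fin: "finite Y" using assms finite_subset by blast
  have "(\<Sum>x\<in>R. ind Y x * of_bool (P x)) = sqrt (real N) * real (card {y \<in> Y. P y})"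
    using sum_ind[OF assms, of "\<lambda>x. of_bool (P x) :: real"] fin by (simp add: of_bool_def sum.If_cases Int_def)
  then show ?thesis using N_pos by (simp add: ip_def field_simps)
qed

definition zero_sums :: "(nat \<Rightarrow> int set) \<Rightarrow> (int \<times> int \<times> int \<times> int \<times> int) set" where
  "zero_sums Y = {(y0, y1, y2, y3, y4). y0 \<in> Y 0 \<and> y1 \<in> Y 1 \<and> y2 \<in> Y 2 \<and> y3 \<in> Y 3 \<and> y4 \<in> Y 4 \<and>
      int N dvd y0 + y1 + y2 + y3 + y4}"

text \<open>Five factors \<open>sqrt N\<close> against \<open>N ^ 4\<close> leave
  \<open>N powr (- 3 / 2)\<close> per solution; the fifth coordinate is determined modulo
  \<open>N\<close> by the other four.\<close>

lemma T_ind_le: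
  assumes Y: "\<And>i. i < 5 \<Longrightarrow> Y i \<subseteq> R"
  shows "T (\<lambda>i. ind (Y i)) \<le> real (card (zero_sums Y)) / real N powr (3 / 2)"
proof -
  let ?P = "\<lambda>y0 y1 y2 y3. y0 \<in> Y 0 \<and> y1 \<in> Y 1 \<and> y2 \<in> Y 2 \<and> y3 \<in> Y 3 \<and> (- (y0 + y1 + y2 + y3)) mod int N \<in> Y 4"
  let ?S = "{(y0, y1, y2, y3). y0 \<in> R \<and> y1 \<in> R \<and> y2 \<in> R \<and> y3 \<in> R \<and> ?P y0 y1 y2 y3}"
  define s where "s = sqrt (real N)"
  have s: "s > 0" "s * s = real N" using N_pos by (auto simp: s_def)
  have finY: "finite (Y i)" if "i < 5" for i using Y[OF that] finite_subset by blast
  have "(\<Sum>y0\<in>R. \<Sum>y1\<in>R. \<Sum>y2\<in>R. \<Sum>y3\<in>R. ind (Y 0) y0 * ind (Y 1) y1 * ind (Y 2) y2 * ind (Y 3) y3 * ind (Y 4) (- (y0 + y1 + y2 + y3)))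
    = (\<Sum>y0\<in>R. \<Sum>y1\<in>R. \<Sum>y2\<in>R. \<Sum>y3\<in>R. s ^ 5 * of_bool (?P y0 y1 y2 y3))"
    by (intro sum.cong refl) (auto simp: ind_def s_def eval_nat_numeral)
  also have "\<dots> = (\<Sum>(y0, y1, y2, y3)\<in>R \<times> R \<times> R \<times> R. s ^ 5 * of_bool (?P y0 y1 y2 y3))"
    by (simp only: sum.cartesian_product)
  also have "\<dots> = (\<Sum>w\<in>?S. s ^ 5)"
    by (intro sum.mono_neutral_cong_right) auto
  also have "\<dots> = real (card ?S) * s ^ 5" by simp
  also have "\<dots> \<le> real (card (zero_sums Y)) * s ^ 5"
  proof (intro mult_right_mono of_nat_mono)
    show "card ?S \<le> card (zero_sums Y)"
    proof (rule card_inj_on_le[where f = "\<lambda>(y0, y1, y2, y3). (y0, y1, y2, y3, (- (y0 + y1 + y2 + y3)) mod int N)"])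
      show "finite (zero_sums Y)"
        by (rule finite_subset[of _ "Y 0 \<times> Y 1 \<times> Y 2 \<times> Y 3 \<times> Y 4"]) (auto simp: zero_sums_def finY)
      have "int N dvd z + (- z) mod int N" for z
        using dvd_mod_diff[of "- z"] by (simp add: add.commute)
      then show "(\<lambda>(y0, y1, y2, y3). (y0, y1, y2, y3, (- (y0 + y1 + y2 + y3)) mod int N)) ` ?S \<subseteq> zero_sums Y"
        unfolding zero_sums_def by (intro image_subsetI) (auto simp del: minus_add_distrib)
    qed (auto simp: inj_on_def)
  qed (use s in auto)
  finally have "T (\<lambda>i. ind (Y i)) \<le> real (card (zero_sums Y)) * s ^ 5 / real N ^ 4"
    unfolding T_def by (rule divide_right_mono) simp
  also have "real N ^ 4 = s ^ 5 * s ^ 3"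
    unfolding s(2)[symmetric] by (simp add: eval_nat_numeral)
  also have "s ^ 3 = real N powr (3 / 2)"
  proof -
    have "s ^ 3 = (real N powr (1 / 2)) powr 3" using N_pos by (simp add: s_def powr_half_sqrt powr_numeral)
    then show ?thesis by (simp add: powr_powr)
  qed
  finally show ?thesis using s by simp
qed

end

section \<open>Removal\<close>

text \<open>An energy increment argument. The scales depend only on \<open>\<epsilon>\<close>, so
  finitely many are considered and one choice of \<open>\<delta>\<close> and \<open>N0\<close>
  serves all of them.\<close>

theorem cyclic_removal:
  fixes \<epsilon> :: real
  assumes \<epsilon>: "\<epsilon> > 0"
  shows "\<exists>\<delta>>0. \<exists>N0>0. \<forall>N\<ge>N0. \<forall>Y :: nat \<Rightarrow> int set.
     (\<forall>i<5. Y i \<subseteq> {0..<int N}) \<longrightarrow> (\<forall>i<5. real (cyclic.nquads N (Y i)) \<le> \<delta> * real N) \<longrightarrow>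
     real (card (cyclic.zero_sums N Y)) \<le> \<delta> * real N powr (3 / 2) \<longrightarrow>
     (\<exists>Y'. (\<forall>i<5. Y' i \<subseteq> Y i \<and> real (card (Y i - Y' i)) \<le> \<epsilon> * sqrt (real N)) \<and>
        (\<forall>y. (\<forall>i<5. y i \<in> Y' i) \<longrightarrow> \<not> int N dvd y 0 + y 1 + y 2 + y 3 + y 4))"
proof -
  define \<kappa> where "\<kappa> = \<epsilon> / 2"
  \<comment> \<open>Solves \<open>sqrt (2 * \<sigma>) / (\<kappa> / 40) = \<epsilon> / 2\<close>,
    the other half of the permitted mass.\<close>
  define \<sigma> where "\<sigma> = (\<kappa> / 40 * \<epsilon>) ^ 2 / 8"
  \<comment> \<open>The intermediate scale, as large as the condition
    \<open>16 * dens \<eta> * \<zeta> / \<eta> \<le> \<kappa>\<close> allows.\<close>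
  define sub_scale where "sub_scale \<eta> = min \<eta> (\<kappa> * \<eta> / (16 * dens \<eta>))" for \<eta>
  \<comment> \<open>The second bound keeps the error of five energy increments below
    \<open>\<sigma> / 2\<close>; the third makes the smoothing error \<open>140 * \<eta>'\<close> at
    most half of the count from \<open>dense_count\<close>.\<close>
  define next_scale where "next_scale \<eta> = min (sub_scale \<eta>) (min (\<sigma> * \<eta> / (160 * dens \<eta>)) ((\<kappa> / 4) ^ 5 / (2 * dens (sub_scale \<eta>) ^ 4) / 280))" for \<eta>
  define eta where "eta k = (next_scale ^^ k) 1" for k
  \<comment> \<open>The total energy stays in \<open>[0, 10]\<close>, so it cannot gain more than
    \<open>\<sigma> / 2\<close> at each of \<open>J\<close> steps.\<close>
  define J where "J = nat \<lceil>20 / \<sigma>\<rceil> + 1"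
  define M where "M = (\<Sum>k\<le>J. dens (eta k) + dens (sub_scale (eta k)))"
  \<comment> \<open>The three bounds serve \<open>near_sidon\<close>, the energy bound
    \<open>E2\<close>, and the bound of \<open>T\<close> by a quarter of the count at scale
    \<open>\<zeta>\<close>.\<close>
  define \<delta> where "\<delta> = min 1 (min (1 / (2 * M)) ((\<kappa> / 4) ^ 5 / (8 * M ^ 4)))"
  \<comment> \<open>Ensures \<open>M * (2 / sqrt N) \<le> 1 / 2\<close>, so that the contribution of
    \<open>card (Y i)\<close> to the energy is harmless.\<close>
  define N0 where "N0 = nat \<lceil>16 * M ^ 2\<rceil> + 1"
  have \<kappa>: "0 < \<kappa>" using \<epsilon> by (simp add: \<kappa>_def)
  have \<sigma>: "0 < \<sigma>" using \<epsilon> \<kappa> by (simp add: \<sigma>_def)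
  have dpos: "0 < dens \<eta>" for \<eta> using dens_ge_1[of \<eta>] by linarith
  have fpos: "0 < sub_scale \<eta>" if "0 < \<eta>" for \<eta> using that \<kappa> dpos by (simp add: sub_scale_def)
  have npos: "0 < next_scale \<eta>" if "0 < \<eta>" for \<eta> unfolding next_scale_def using that \<kappa> \<sigma> dpos fpos
    by (intro min_less_iff_conj[THEN iffD2] conjI divide_pos_pos mult_pos_pos zero_less_power) auto
  have epos: "0 < eta k" for k by (induction k) (auto simp: eta_def npos)
  have eta_Suc: "eta (Suc k) = next_scale (eta k)" for k by (simp add: eta_def)
  have M_ge: "dens (eta k) \<le> M" "dens (sub_scale (eta k)) \<le> M" if "k \<le> J" for k
  proof -
    have "dens (eta k) + dens (sub_scale (eta k)) \<le> M"
      unfolding M_def using that dpos by (intro member_le_sum[of k]) (auto intro: add_nonneg_nonneg less_imp_le)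
    then show "dens (eta k) \<le> M" "dens (sub_scale (eta k)) \<le> M" using dpos[of "eta k"] dpos[of "sub_scale (eta k)"] by linarith+
  qed
  have M1: "1 \<le> M" using M_ge(1)[of 0] dens_ge_1[of "eta 0"] by simp
  have \<delta>: "0 < \<delta>" using M1 \<kappa> by (simp add: \<delta>_def)
  have "\<exists>Y'. (\<forall>i<5. Y' i \<subseteq> Y i \<and> real (card (Y i - Y' i)) \<le> \<epsilon> * sqrt (real N)) \<and>
        (\<forall>y. (\<forall>i<5. y i \<in> Y' i) \<longrightarrow> \<not> int N dvd y 0 + y 1 + y 2 + y 3 + y 4)"
    if N: "N \<ge> N0" and Y: "\<And>i. i < 5 \<Longrightarrow> Y i \<subseteq> {0..<int N}"
      and quads: "\<And>i. i < 5 \<Longrightarrow> real (cyclic.nquads N (Y i)) \<le> \<delta> * real N"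
      and sols: "real (card (cyclic.zero_sums N Y)) \<le> \<delta> * real N powr (3 / 2)" for N Y
  proof -
    have Npos: "N > 0" using N by (simp add: N0_def)
    interpret cyclic N by standard (rule Npos)
    have "\<delta> \<le> 1" by (simp add: \<delta>_def)
    then have dN: "\<delta> * real N \<le> real N" using \<delta> by (intro mult_left_le_one_le) auto
    note sidon = near_sidon[OF Y order_trans[OF quads dN]]
    have cardY: "real (card (Y i)) \<le> 2 * sqrt (real N)" if "i < 5" for i
    proof (rule power2_le_imp_le)
      show "real (card (Y i)) ^ 2 \<le> (2 * sqrt (real N)) ^ 2"
        using sidon(1)[OF that that] by (simp add: power_mult_distrib)
    qed simp
    interpret scales N "\<lambda>i. ind (Y i)"
    proof
      fix i x assume i: "i < (5::nat)"
      show "periodic (ind (Y i))" "0 \<le> ind (Y i) x" by (rule periodic_ind ind_nonneg)+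
      have "(\<Sum>x\<in>R. ind (Y i) x) = sqrt (real N) * real (card (Y i))"
        using sum_ind[OF Y[OF i], of "\<lambda>_. 1::real"] by simp
      also have "\<dots> \<le> sqrt (real N) * (2 * sqrt (real N))"
        using cardY[OF i] by (intro mult_left_mono) auto
      also have "\<dots> = 2 * real N" by (subst mult.left_commute) simp
      finally show "(\<Sum>x\<in>R. ind (Y i) x) \<le> 2 * real N" .
      show "(\<Sum>k\<in>R. cmod (ft (ind (Y i)) k) ^ 4) \<le> 7"
        unfolding ft_ind_power4[OF Y[OF i]] using sidon(2)[OF i i] Npos by (simp add: field_simps)
    qed
    have E2: "E \<eta> i \<le> 2" if i: "i < 5" and "0 < \<eta>" and dM: "dens \<eta> \<le> M" for \<eta> i
    proof -
      have "E \<eta> i \<le> 1 + dens \<eta> / real N * (real (card (Y i)) + real (nquads (Y i)))"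
        unfolding E_def using that by (intro energy_bound Y kernel_ker ker_le)
      also have "\<dots> \<le> 1 + M / real N * (2 * sqrt (real N) + \<delta> * real N)"
        using dM cardY[OF i] quads[OF i] M1 by (intro add_left_mono mult_mono divide_right_mono add_mono) auto
      also have "M / real N * (2 * sqrt (real N) + \<delta> * real N) = M * (2 / sqrt (real N)) + M * \<delta>"
      proof -
        have "sqrt (real N) / real N = 1 / sqrt (real N)" using Npos by (simp add: real_div_sqrt field_simps)
        then show ?thesis using Npos by (simp add: distrib_left field_simps)
      qed
      also have "M * (2 / sqrt (real N)) \<le> 1 / 2"
      proof -
        have "16 * M ^ 2 \<le> real N" using N unfolding N0_def by linarith
        then have "4 * M \<le> sqrt (real N)" by (intro real_le_rsqrt) (simp add: power_mult_distrib)
        then show ?thesis using Npos by (simp add: field_simps)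
      qed
      also have "M * \<delta> \<le> M * (1 / (2 * M))" using M1 by (intro mult_left_mono) (auto simp: \<delta>_def)
      finally show ?thesis using M1 by simp
    qed
    \<comment> \<open>Adding the five energies makes one scale work for all five sets at
      once.\<close>
    define tot where "tot k = (\<Sum>i<5. E (eta k) i)" for k
    have tot10: "tot k \<le> 10" if "k \<le> J" for k
    proof -
      have "tot k \<le> (\<Sum>i<(5::nat). 2)" unfolding tot_def using that epos M_ge by (intro sum_mono E2) auto
      then show ?thesis by simp
    qed
    have "\<exists>k<J. tot (Suc k) - tot k \<le> \<sigma> / 2"
    proof (rule ccontr)
      assume "\<not> ?thesis"
      then have step: "tot k + \<sigma> / 2 \<le> tot (Suc k)" if "k < J" for k using that by force
      have "tot 0 + real k * (\<sigma> / 2) \<le> tot k" if "k \<le> J" for k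
        using that
      proof (induction k)
        case (Suc k)
        then show ?case using step[of k] by (simp add: distrib_right add_divide_distrib)
      qed simp
      from this[of J] have "tot 0 + real J * (\<sigma> / 2) \<le> 10" using tot10[of J] by simp
      moreover have "0 \<le> tot 0" unfolding tot_def E_def by (intro sum_nonneg) (simp add: ip_def sum_nonneg)
      moreover have "20 / \<sigma> < real J" unfolding J_def by linarith
      then have "10 < real J * (\<sigma> / 2)" using \<sigma> by (simp add: field_simps)
      ultimately show False by linarith
    qed
    then obtain k where k: "k < J" "tot (Suc k) - tot k \<le> \<sigma> / 2" by blast
    define \<eta> where "\<eta> = eta k"
    define \<zeta> where "\<zeta> = sub_scale \<eta>"
    define \<eta>' where "\<eta>' = next_scale \<eta>"
    have \<eta>: "0 < \<eta>" by (simp add: \<eta>_def epos)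
    have scal: "0 < \<eta>'" "\<eta>' \<le> \<zeta>" "\<zeta> \<le> \<eta>"
      using npos[OF \<eta>] by (auto simp: \<eta>'_def \<zeta>_def next_scale_def sub_scale_def)
    \<comment> \<open>Each increment is nonnegative and so bounded by the sum of all five:
      \<open>\<sigma> / 2\<close> from the choice of \<open>k\<close> and
      \<open>80 * \<sigma> / 160\<close> from the error terms.\<close>
    have inc: "ip (D \<eta> \<eta>' i) (D \<eta> \<eta>' i) \<le> \<sigma>" if i: "i < 5" for i
    proof -
      have nn: "0 \<le> ip (D \<eta> \<eta>' i) (D \<eta> \<eta>' i)" for i by (intro ip_nonneg D_nonneg)
      have "ip (D \<eta> \<eta>' i) (D \<eta> \<eta>' i) \<le> (\<Sum>i<5. ip (D \<eta> \<eta>' i) (D \<eta> \<eta>' i))"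
        using i nn by (intro member_le_sum[of i]) auto
      also have "\<dots> \<le> (\<Sum>i<5. E \<eta>' i - E \<eta> i + 16 * dens \<eta> * \<eta>' / \<eta>)"
        using scal by (intro sum_mono energy_increment) auto
      also have "\<dots> = (tot (Suc k) - tot k) + 80 * (dens \<eta> * \<eta>' / \<eta>)"
        by (simp add: sum.distrib sum_subtractf tot_def eta_Suc \<eta>_def \<eta>'_def)
      also have "dens \<eta> * \<eta>' / \<eta> \<le> \<sigma> / 160"
      proof -
        have "\<eta>' \<le> \<sigma> * \<eta> / (160 * dens \<eta>)" by (simp add: \<eta>'_def next_scale_def)
        then show ?thesis using \<eta> dpos[of \<eta>] by (simp add: field_simps)
      qed
      finally show ?thesis using k(2) by simp
    qed
    have sub_small: "16 * dens \<eta> * \<zeta> / \<eta> \<le> \<kappa>"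
    proof -
      have "\<zeta> \<le> \<kappa> * \<eta> / (16 * dens \<eta>)" by (simp add: \<zeta>_def sub_scale_def)
      then show ?thesis using \<eta> dpos[of \<eta>] by (simp add: field_simps)
    qed
    have count: "T (\<lambda>i. ind (Y i)) + 140 * \<eta>' < (\<kappa> / 4) ^ 5 / (2 * dens \<zeta> ^ 4)" (is "_ < ?c")
    proof -
      have cpos: "0 < ?c" using \<kappa> dpos[of \<zeta>] by simp
      have "T (\<lambda>i. ind (Y i)) \<le> real (card (zero_sums Y)) / real N powr (3 / 2)"
        by (rule T_ind_le[OF Y])
      also have "\<dots> \<le> \<delta>" using sols Npos by (simp add: field_simps)
      also have "\<dots> \<le> (\<kappa> / 4) ^ 5 / (8 * M ^ 4)" by (simp add: \<delta>_def)
      also have "\<dots> \<le> (\<kappa> / 4) ^ 5 / (8 * dens \<zeta> ^ 4)"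
        using M_ge(2)[of k] k \<kappa> dpos[of \<zeta>] M1
        by (intro divide_left_mono mult_left_mono power_mono mult_pos_pos zero_less_power) (auto simp: \<zeta>_def \<eta>_def less_imp_le)
      also have "\<dots> = ?c / 4" by simp
      finally have "T (\<lambda>i. ind (Y i)) \<le> ?c / 4" .
      moreover have "\<eta>' \<le> ?c / 280" by (simp add: \<eta>'_def \<zeta>_def next_scale_def)
      moreover have "t + 140 * u < c" if "t \<le> c / 4" "u \<le> c / 280" "0 < c" for t u c :: real
        using that by linarith
      ultimately show ?thesis using cpos by blast
    qed
    have E_zeta: "E \<zeta> i \<le> 2" if "i < 5" for i
      using that scal M_ge(2)[of k] k by (intro E2) (auto simp: \<zeta>_def \<eta>_def)
    obtain bad where bad: "\<And>i. i < 5 \<Longrightarrow> ip (ind (Y i)) (\<lambda>x. of_bool (bad i x)) \<le> \<kappa> + sqrt (2 * \<sigma>) / (\<kappa> / 40)"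
      and free: "\<And>x. (\<forall>i<5. \<not> bad i (x i)) \<Longrightarrow> \<not> int N dvd x 0 + x 1 + x 2 + x 3 + x 4"
      using removal_step[OF scal \<kappa> sub_small E_zeta inc count] by blast
    have mass: "\<kappa> + sqrt (2 * \<sigma>) / (\<kappa> / 40) = \<epsilon>"
    proof -
      have "2 * \<sigma> = (\<kappa> / 40 * \<epsilon> / 2) ^ 2" by (simp add: \<sigma>_def power_divide)
      then have "sqrt (2 * \<sigma>) = \<kappa> / 40 * \<epsilon> / 2" using \<kappa> \<epsilon> by (simp only: real_sqrt_abs) simp
      then have "sqrt (2 * \<sigma>) / (\<kappa> / 40) = \<epsilon> / 2" using \<kappa> by (simp add: field_simps)
      then show ?thesis by (simp add: \<kappa>_def)
    qed
    define Y' where "Y' i = {y \<in> Y i. \<not> bad i y}" for i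
    have "real (card (Y i - Y' i)) \<le> \<epsilon> * sqrt (real N)" if i: "i < 5" for i
    proof -
      have "Y i - Y' i = {y \<in> Y i. bad i y}" by (auto simp: Y'_def)
      moreover have "real (card {y \<in> Y i. bad i y}) / sqrt (real N) \<le> \<epsilon>"
        using bad[OF i] unfolding mass ip_ind[OF Y[OF i]] .
      ultimately show ?thesis using Npos by (simp add: field_simps)
    qed
    moreover have "\<not> int N dvd y 0 + y 1 + y 2 + y 3 + y 4" if "\<forall>i<5. y i \<in> Y' i" for y
      using that by (intro free) (auto simp: Y'_def)
    ultimately show ?thesis by (intro exI[of _ Y']) (auto simp: Y'_def)
  qed
  then show ?thesis using \<delta> by (intro exI[of _ \<delta>] conjI exI[of _ N0]) (auto simp: N0_def)
qed

section \<open>Transfer from the integers to residues\<close>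

theorem theorem1p17:
  fixes a :: "nat \<Rightarrow> int"
  assumes nz: "\<forall>i<5. a i \<noteq> 0"
    and sum0: "(\<Sum>i<5. a i) = 0"
  shows "\<forall>\<epsilon>>0. \<exists>\<delta>>0. \<exists>n0::nat. \<forall>n\<ge>n0. \<forall>X :: nat \<Rightarrow> int set.
           (\<forall>i<5. X i \<subseteq> {1..int n}) \<longrightarrow>
           (\<forall>i<5. real (nontriv_add_quads (X i)) \<le> \<delta> * real n) \<longrightarrow>
           real (card (lin_solutions a X)) \<le> \<delta> * real n powr (3/2) \<longrightarrow>
           (\<exists>X' :: nat \<Rightarrow> int set. (\<forall>i<5. X' i \<subseteq> X i \<and>
                 real (card (X i - X' i)) \<le> \<epsilon> * sqrt (real n)) \<and>
              lin_solutions a X' = {})"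
proof (intro allI impI)
  fix \<epsilon> :: real assume \<epsilon>: "\<epsilon> > 0"
  define S where "S = (\<Sum>i<5. \<bar>a i\<bar>)"
  \<comment> \<open>With \<open>N = C * n > 4 * S * n\<close> neither the quadruples nor the linear
    equation can wrap around modulo \<open>N\<close>.\<close>
  define C where "C = nat (4 * S) + 1"
  have aS: "\<bar>a i\<bar> \<le> S" if "i < 5" for i
    unfolding S_def using that by (intro member_le_sum[of i]) auto
  have S0: "0 \<le> S" by (simp add: S_def sum_nonneg)
  have C: "int C = 4 * S + 1" using S0 by (simp add: C_def)
  have C1: "1 \<le> C" by (simp add: C_def)
  \<comment> \<open>Compensates for \<open>sqrt N = sqrt C * sqrt n\<close>.\<close>
  have "\<epsilon> / sqrt (real C) > 0" using \<epsilon> C1 by simp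
  from cyclic_removal[OF this] obtain \<delta> N0 where \<delta>: "\<delta> > 0" and N0: "N0 > 0" and core: "\<forall>N\<ge>N0. \<forall>Y :: nat \<Rightarrow> int set.
     (\<forall>i<5. Y i \<subseteq> {0..<int N}) \<longrightarrow> (\<forall>i<5. real (cyclic.nquads N (Y i)) \<le> \<delta> * real N) \<longrightarrow>
     real (card (cyclic.zero_sums N Y)) \<le> \<delta> * real N powr (3 / 2) \<longrightarrow>
     (\<exists>Y'. (\<forall>i<5. Y' i \<subseteq> Y i \<and> real (card (Y i - Y' i)) \<le> \<epsilon> / sqrt (real C) * sqrt (real N)) \<and>
        (\<forall>y. (\<forall>i<5. y i \<in> Y' i) \<longrightarrow> \<not> int N dvd y 0 + y 1 + y 2 + y 3 + y 4))"
    by (elim exE conjE) (rule that)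
  have "\<exists>X' :: nat \<Rightarrow> int set. (\<forall>i<5. X' i \<subseteq> X i \<and> real (card (X i - X' i)) \<le> \<epsilon> * sqrt (real n)) \<and>
              lin_solutions a X' = {}"
    if n: "n \<ge> N0" and X: "\<And>i. i < 5 \<Longrightarrow> X i \<subseteq> {1..int n}"
      and quads: "\<And>i. i < 5 \<Longrightarrow> real (nontriv_add_quads (X i)) \<le> \<delta> * real n"
      and sols: "real (card (lin_solutions a X)) \<le> \<delta> * real n powr (3/2)" for n and X :: "nat \<Rightarrow> int set"
  proof -
    define N where "N = C * n"
    have n0: "n > 0" using n N0 by simp
    have Nn: "n \<le> N" using C1 by (simp add: N_def)
    have Npos: "N > 0" using n0 Nn by simp
    interpret cyclic N by standard (rule Npos)
    have SN: "4 * S * int n < int N"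
      unfolding N_def of_nat_mult C using n0 by (simp add: algebra_simps)
    have dvd0: "z = 0" if "int N dvd z" "\<bar>z\<bar> \<le> 4 * S * int n" for z
      using dvd_imp_le_int[of z "int N"] that SN by force
    \<comment> \<open>Dilating by \<open>a i\<close> turns the linear equation into a zero sum; the
      map is injective on \<open>X i\<close> because \<open>a i\<close> is nonzero and nothing wraps
      around.\<close>
    define \<phi> where "\<phi> i x = (a i * x) mod int N" for i x
    define Y where "Y i = \<phi> i ` X i" for i
    have finX: "finite (X i)" if "i < 5" for i using X[OF that] finite_subset by blast
    have Xb: "\<bar>x\<bar> \<le> int n" if "i < 5" "x \<in> X i" for i x using X that by fastforce
    have \<phi>_dvd: "int N dvd \<phi> i x - a i * x" for i x unfolding \<phi>_def by (rule dvd_mod_diff)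
    have inj: "inj_on (\<phi> i) (X i)" if i: "i < 5" for i
    proof (rule inj_onI)
      fix x y assume x: "x \<in> X i" and y: "y \<in> X i" and eq: "\<phi> i x = \<phi> i y"
      have "int N dvd a i * (x - y)"
        using eq unfolding \<phi>_def by (simp add: mod_eq_dvd_iff right_diff_distrib)
      moreover have "\<bar>a i * (x - y)\<bar> \<le> 4 * S * int n"
      proof -
        have "\<bar>a i * (x - y)\<bar> \<le> S * (4 * int n)"
          unfolding abs_mult using aS[OF i] Xb[OF i x] Xb[OF i y] S0 by (intro mult_mono) auto
        then show ?thesis by simp
      qed
      ultimately have "a i * (x - y) = 0" by (rule dvd0)
      then show "x = y" using nz i by simp
    qed
    have YR: "Y i \<subseteq> {0..<int N}" for i using mod_in_R by (auto simp: Y_def \<phi>_def)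
    have quadsY: "nquads (Y i) \<le> nontriv_add_quads (X i)" if i: "i < 5" for i
    proof -
      let ?QX = "{(x1, x2, x3, x4). x1 \<in> X i \<and> x2 \<in> X i \<and> x3 \<in> X i \<and> x4 \<in> X i \<and>
        x1 + x2 = x3 + x4 \<and> \<not> ((x1, x2) = (x3, x4)) \<and> \<not> ((x1, x2) = (x4, x3))}"
      let ?F = "\<lambda>(x1, x2, x3, x4). (\<phi> i x1, \<phi> i x2, \<phi> i x3, \<phi> i x4)"
      have fin: "finite ?QX"
        by (rule finite_subset[of _ "X i \<times> X i \<times> X i \<times> X i"]) (use finX[OF i] in auto)
      \<comment> \<open>Every nontrivial quadruple modulo \<open>N\<close> lifts to one in the
        integers, so the dilated set has no new ones.\<close>
      have "nquads (Y i) \<le> card (?F ` ?QX)"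
        unfolding nquads_def
      proof (rule card_mono[OF finite_imageI[OF fin]], clarify)
        fix y0 y1 y2 y3
        assume y: "y0 \<in> Y i" "y1 \<in> Y i" "y2 \<in> Y i" "y3 \<in> Y i" and dv: "int N dvd y0 + y1 - y2 - y3"
          and nt: "\<not> (y0 = y2 \<and> y1 = y3)" "\<not> (y0 = y3 \<and> y1 = y2)"
        obtain x0 x1 x2 x3 where x: "x0 \<in> X i" "x1 \<in> X i" "x2 \<in> X i" "x3 \<in> X i"
          and yx: "y0 = \<phi> i x0" "y1 = \<phi> i x1" "y2 = \<phi> i x2" "y3 = \<phi> i x3"
          using y unfolding Y_def by blast
        have "a i * (x0 + x1 - x2 - x3) = (y0 + y1 - y2 - y3) - (y0 - a i * x0) - (y1 - a i * x1)
            + (y2 - a i * x2) + (y3 - a i * x3)" by (simp add: algebra_simps)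
        also have "int N dvd \<dots>" unfolding yx
          by (intro dv[unfolded yx] \<phi>_dvd dvd_add dvd_diff)
        finally have "int N dvd a i * (x0 + x1 - x2 - x3)" .
        moreover have "\<bar>a i * (x0 + x1 - x2 - x3)\<bar> \<le> 4 * S * int n"
        proof -
          have "\<bar>x0 + x1 - x2 - x3\<bar> \<le> 4 * int n"
            using x[THEN Xb[OF i]] by linarith
          then have "\<bar>a i * (x0 + x1 - x2 - x3)\<bar> \<le> S * (4 * int n)"
            unfolding abs_mult using aS[OF i] S0 by (intro mult_mono) auto
          then show ?thesis by simp
        qed
        ultimately have "a i * (x0 + x1 - x2 - x3) = 0" by (rule dvd0)
        then have "x0 + x1 = x2 + x3" using nz i by simp
        then have "(x0, x1, x2, x3) \<in> ?QX" using x nt yx by auto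
        then show "(y0, y1, y2, y3) \<in> ?F ` ?QX" using yx by (intro image_eqI[of _ _ "(x0, x1, x2, x3)"]) auto
      qed
      also have "\<dots> \<le> card ?QX" by (rule card_image_le[OF fin])
      finally show ?thesis by (simp only: nontriv_add_quads_def)
    qed
    have sum5: "(\<Sum>i<5. g i) = g 0 + g 1 + g 2 + g 3 + g 4" for g :: "nat \<Rightarrow> int"
      by (simp add: eval_nat_numeral)
    have solsY: "card (zero_sums Y) \<le> card (lin_solutions a X)"
    proof -
      let ?F = "\<lambda>x :: nat \<Rightarrow> int. (\<phi> 0 (x 0), \<phi> 1 (x 1), \<phi> 2 (x 2), \<phi> 3 (x 3), \<phi> 4 (x 4))"
      have fin: "finite (lin_solutions a X)"
        by (rule finite_subset[of _ "PiE {0..<5} X"]) (auto simp: lin_solutions_def intro!: finite_PiE finX)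
      have "card (zero_sums Y) \<le> card (?F ` lin_solutions a X)"
      proof (rule card_mono[OF finite_imageI[OF fin]], rule subsetI)
        fix w assume "w \<in> zero_sums Y"
        then obtain y0 y1 y2 y3 y4 where w: "w = (y0, y1, y2, y3, y4)"
          and y: "y0 \<in> Y 0" "y1 \<in> Y 1" "y2 \<in> Y 2" "y3 \<in> Y 3" "y4 \<in> Y 4"
          and dv: "int N dvd y0 + y1 + y2 + y3 + y4" unfolding zero_sums_def by blast
        obtain x0 x1 x2 x3 x4 where x: "x0 \<in> X 0" "x1 \<in> X 1" "x2 \<in> X 2" "x3 \<in> X 3" "x4 \<in> X 4"
          and yx: "y0 = \<phi> 0 x0" "y1 = \<phi> 1 x1" "y2 = \<phi> 2 x2" "y3 = \<phi> 3 x3" "y4 = \<phi> 4 x4"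
          using y unfolding Y_def by blast
        \<comment> \<open>The final branch is index 4; restriction gives the extensional function
          demanded by \<open>PiE\<close>.\<close>
        define x where "x = (\<lambda>i\<in>{0..<5::nat}. if i = 0 then x0 else if i = 1 then x1 else if i = 2 then x2 else if i = 3 then x3 else x4)"
        have xs: "x 0 = x0" "x 1 = x1" "x 2 = x2" "x 3 = x3" "x 4 = x4" by (auto simp: x_def)
        have xP: "x \<in> PiE {0..<5} X"
        proof (rule PiE_I)
          fix i :: nat assume "i \<in> {0..<5}"
          then have "i = 0 \<or> i = 1 \<or> i = 2 \<or> i = 3 \<or> i = 4" by auto
          then show "x i \<in> X i" using x xs by auto
        qed (simp add: x_def)
        have "(\<Sum>i<5. a i * x i) = (y0 + y1 + y2 + y3 + y4) - (y0 - a 0 * x0) - (y1 - a 1 * x1)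
            - (y2 - a 2 * x2) - (y3 - a 3 * x3) - (y4 - a 4 * x4)" unfolding sum5 xs by simp
        also have "int N dvd \<dots>" unfolding yx
          by (intro dv[unfolded yx] \<phi>_dvd dvd_diff)
        finally have "int N dvd (\<Sum>i<5. a i * x i)" .
        moreover have "\<bar>\<Sum>i<5. a i * x i\<bar> \<le> 4 * S * int n"
        proof -
          have "\<bar>\<Sum>i<5. a i * x i\<bar> \<le> (\<Sum>i<5. \<bar>a i\<bar> * int n)"
          proof (rule order_trans[OF sum_abs sum_mono])
            fix i :: nat assume "i \<in> {..<5}"
            then show "\<bar>a i * x i\<bar> \<le> \<bar>a i\<bar> * int n"
              unfolding abs_mult using xP Xb[of i "x i"] by (intro mult_left_mono) (auto simp: PiE_iff)
          qed
          also have "\<dots> = S * int n" by (simp add: S_def sum_distrib_right)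
          also have "\<dots> \<le> 4 * S * int n" using S0 by (intro mult_right_mono) auto
          finally show ?thesis .
        qed
        ultimately have "(\<Sum>i<5. a i * x i) = 0" by (rule dvd0)
        then have "x \<in> lin_solutions a X" using xP by (simp add: lin_solutions_def)
        moreover have "w = ?F x" by (simp only: w yx xs)
        ultimately show "w \<in> ?F ` lin_solutions a X" by blast
      qed
      also have "\<dots> \<le> card (lin_solutions a X)" by (rule card_image_le[OF fin])
      finally show ?thesis .
    qed
    have "\<exists>Y'. (\<forall>i<5. Y' i \<subseteq> Y i \<and> real (card (Y i - Y' i)) \<le> \<epsilon> / sqrt (real C) * sqrt (real N)) \<and>
        (\<forall>y. (\<forall>i<5. y i \<in> Y' i) \<longrightarrow> \<not> int N dvd y 0 + y 1 + y 2 + y 3 + y 4)"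
    proof (rule core[rule_format])
      show "N0 \<le> N" using n Nn by simp
      show "Y i \<subseteq> {0..<int N}" for i by (rule YR)
      show "real (nquads (Y i)) \<le> \<delta> * real N" if "i < 5" for i
      proof -
        have "real (nquads (Y i)) \<le> \<delta> * real n" using quadsY[OF that] quads[OF that] by linarith
        also have "\<dots> \<le> \<delta> * real N" using Nn \<delta> by (intro mult_left_mono) auto
        finally show ?thesis .
      qed
      have "real (card (zero_sums Y)) \<le> \<delta> * real n powr (3 / 2)" using solsY sols by linarith
      also have "\<dots> \<le> \<delta> * real N powr (3 / 2)"
        using Nn \<delta> by (intro mult_left_mono powr_mono2) auto
      finally show "real (card (zero_sums Y)) \<le> \<delta> * real N powr (3 / 2)" .
    qed
    then obtain Y' where Y': "\<And>i. i < 5 \<Longrightarrow> Y' i \<subseteq> Y i"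
      "\<And>i. i < 5 \<Longrightarrow> real (card (Y i - Y' i)) \<le> \<epsilon> / sqrt (real C) * sqrt (real N)"
      and free: "\<And>y. (\<forall>i<5. y i \<in> Y' i) \<Longrightarrow> \<not> int N dvd y 0 + y 1 + y 2 + y 3 + y 4"
      by blast
    \<comment> \<open>Pulling back along the injective dilation removes no more elements than were
      removed from \<open>Y i\<close>.\<close>
    define X' where "X' i = {x \<in> X i. \<phi> i x \<in> Y' i}" for i
    have "real (card (X i - X' i)) \<le> \<epsilon> * sqrt (real n)" if i: "i < 5" for i
    proof -
      have "card (X i - X' i) \<le> card (Y i - Y' i)"
      proof (rule card_inj_on_le)
        show "inj_on (\<phi> i) (X i - X' i)" using inj[OF i] by (rule inj_on_subset) auto
        show "finite (Y i - Y' i)" using finX[OF i] by (simp add: Y_def)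
      qed (auto simp: X'_def Y_def)
      then have "real (card (X i - X' i)) \<le> \<epsilon> / sqrt (real C) * sqrt (real N)"
        using Y'(2)[OF i] by linarith
      also have "\<dots> = \<epsilon> * sqrt (real n)"
        using C1 by (simp add: N_def real_sqrt_mult)
      finally show ?thesis .
    qed
    moreover have "lin_solutions a X' = {}"
    proof (rule ccontr)
      assume "lin_solutions a X' \<noteq> {}"
      then obtain x where xP: "x \<in> PiE {0..<5} X'" and sol: "(\<Sum>i<5. a i * x i) = 0"
        by (auto simp: lin_solutions_def)
      have "\<forall>i<5. \<phi> i (x i) \<in> Y' i" using xP by (auto simp: PiE_iff X'_def)
      then have nd: "\<not> int N dvd \<phi> 0 (x 0) + \<phi> 1 (x 1) + \<phi> 2 (x 2) + \<phi> 3 (x 3) + \<phi> 4 (x 4)"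
        by (rule free)
      have "\<phi> 0 (x 0) + \<phi> 1 (x 1) + \<phi> 2 (x 2) + \<phi> 3 (x 3) + \<phi> 4 (x 4) =
        (\<phi> 0 (x 0) - a 0 * x 0) + (\<phi> 1 (x 1) - a 1 * x 1) + (\<phi> 2 (x 2) - a 2 * x 2)
          + (\<phi> 3 (x 3) - a 3 * x 3) + (\<phi> 4 (x 4) - a 4 * x 4)"
        using sol unfolding sum5 by linarith
      also have "int N dvd \<dots>" by (intro \<phi>_dvd dvd_add)
      finally show False using nd by simp
    qed
    ultimately show ?thesis by (intro exI[of _ X']) (auto simp: X'_def)
  qed
  then show "\<exists>\<delta>>0. \<exists>n0::nat. \<forall>n\<ge>n0. \<forall>X :: nat \<Rightarrow> int set.
           (\<forall>i<5. X i \<subseteq> {1..int n}) \<longrightarrow>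
           (\<forall>i<5. real (nontriv_add_quads (X i)) \<le> \<delta> * real n) \<longrightarrow>
           real (card (lin_solutions a X)) \<le> \<delta> * real n powr (3/2) \<longrightarrow>
           (\<exists>X' :: nat \<Rightarrow> int set. (\<forall>i<5. X' i \<subseteq> X i \<and>
                 real (card (X i - X' i)) \<le> \<epsilon> * sqrt (real n)) \<and>
              lin_solutions a X' = {})"
    using \<delta> by (intro exI[of _ \<delta>] conjI exI[of _ N0]) auto
qed

end
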